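(* Let $Q(z)$ be an $\mathbf{N}_1$ function and, for $\tau\in\mathbb{R}\cup\{\infty\}$, let $\alpha(\tau)$ be the generalized zero of nonpositive type of $Q_\tau(z)$. Then the function $\tau\mapsto\alpha(\tau)$ is continuous (from $\mathbb{R}\cup\{\infty\}$ to the Riemann sphere), and the set $$\{\alpha(\tau):\ \tau\in\mathbb{R}\cup\{\infty\}\}$$ on the Riemann sphere is homeomorphic to a circle.
   Context: $\mathbb{C}^+$ is the open upper half-plane. A Nevanlinna function is a function $M$ holomorphic on $\mathbb{C}\setminus\mathbb{R}$, with $\overline{M(z)}=M(\bar z)$, mapping $\mathbb{C}^+$ into $\mathbb{C}^+\cup\mathbb{R}$. The class $\mathbf{N}_1$ consists of functions $Q$ meromorphic on $\mathbb{C}^+$ for which the kernel $\mathsf{N}_Q(z,w)=\frac{Q(z)-\overline{Q(w)}}{z-\bar w}$, $z,w\in\mathbb{C}^+$ (points of holomorphy), has precisely one negative square: every Hermitian matrix $(\mathsf{N}_Q(z_i,z_j))_{i,j}$ has at most one negative eigenvalue (with multiplicity), and at least one such matrix has exactly one. It is known that each $Q\in\mathbf{N}_1$ has a unique factorization $Q=RM$ with $M$ a Nevanlinna function and $R(z)$ of one of the forms $\frac{(z-\alpha)(z-\bar\alpha)}{(z-\beta)(z-\bar\beta)}$, $(z-\alpha)(z-\bar\alpha)$, $\frac{1}{(z-\beta)(z-\bar\beta)}$, with $\alpha,\beta\in\mathbb{C}^+\cup\mathbb{R}$; $\alpha$ is called the generalized zero of nonpositive type (GZNT) and $\beta$ the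 generalized pole of nonpositive type (GPNT) of $Q$, where $\beta=\infty$ in the second form and $\alpha=\infty$ in the third form. For $\tau\in\mathbb{R}$ put $Q_\tau(z)=\frac{Q(z)-\tau}{1+\tau Q(z)}$ and put $Q_\infty(z)=-1/Q(z)$. It is known that $Q_\tau\in\mathbf{N}_1$ for all $\tau\in\mathbb{R}\cup\{\infty\}$, so $\alpha(\tau)\in\mathbb{C}^+\cup\mathbb{R}\cup\{\infty\}$ is well defined. $\mathbb{R}\cup\{\infty\}$ carries the topology of the one-point compactification (as a subset of the Riemann sphere). *)

theory Defs
  imports "HOL-Complex_Analysis.Complex_Analysis" "Jordan_Normal_Form.Char_Poly"
begin

abbreviation upper_half_plane :: "complex set" where
  "upper_half_plane \<equiv> {z. Im z > 0}"

definition nevanlinna :: "(complex \<Rightarrow> complex) \<Rightarrow> bool" where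
  "nevanlinna M \<longleftrightarrow>
     M holomorphic_on {z. Im z \<noteq> 0} \<and>
     (\<forall>z. Im z \<noteq> 0 \<longrightarrow> cnj (M z) = M (cnj z)) \<and>
     (\<forall>z. Im z > 0 \<longrightarrow> Im (M z) \<ge> 0)"

definition nevanlinna_kernel :: "(complex \<Rightarrow> complex) \<Rightarrow> complex \<Rightarrow> complex \<Rightarrow> complex" where
  "nevanlinna_kernel Q z w = (Q z - cnj (Q w)) / (z - cnj w)"

definition nevanlinna_matrix :: "(complex \<Rightarrow> complex) \<Rightarrow> complex list \<Rightarrow> complex mat" where
  "nevanlinna_matrix Q zs =
     Matrix.mat (length zs) (length zs) (\<lambda>(i, j). nevanlinna_kernel Q (zs ! i) (zs ! j))"

text \<open>The number of negative eigenvalues, counted with (algebraic) multiplicity.\<close>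

definition num_neg_eigenvalues :: "complex mat \<Rightarrow> nat" where
  "num_neg_eigenvalues A = size {#\<mu> \<in># proots (char_poly A). \<mu> \<in> \<real> \<and> Re \<mu> < 0#}"

text \<open>
  A function that is meromorphic on the half-plane may carry arbitrary values on a sparse set
  (its poles and removable singularities). The kernel is sampled only where \<open>Q\<close> is analytic,
  so these values play no role.
\<close>

definition class_N1 :: "(complex \<Rightarrow> complex) \<Rightarrow> bool" where
  "class_N1 Q \<longleftrightarrow>
     Q meromorphic_on upper_half_plane \<and>
     (\<forall>zs. set zs \<subseteq> {z \<in> upper_half_plane. Q analytic_on {z}} \<longrightarrow>
        num_neg_eigenvalues (nevanlinna_matrix Q zs) \<le> 1) \<and>
     (\<exists>zs. set zs \<subseteq> {z \<in> upper_half_plane. Q analytic_on {z}} \<and>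
        num_neg_eigenvalues (nevanlinna_matrix Q zs) = 1)"

text \<open>
  \<open>n1_factor a b R\<close>: \<open>R\<close> is one of the three admissible rational factors, with zero parameter
  \<open>a\<close> and pole parameter \<open>b\<close>; the point at infinity is \<open>None\<close>.
\<close>

inductive n1_factor :: "complex option \<Rightarrow> complex option \<Rightarrow> (complex \<Rightarrow> complex) \<Rightarrow> bool" where
  both_finite: "\<lbrakk>Im a \<ge> 0; Im b \<ge> 0\<rbrakk> \<Longrightarrow>
     n1_factor (Some a) (Some b) (\<lambda>z. ((z - a) * (z - cnj a)) / ((z - b) * (z - cnj b)))"
| pole_at_infinity: "Im a \<ge> 0 \<Longrightarrow>
     n1_factor (Some a) None (\<lambda>z. (z - a) * (z - cnj a))"
| zero_at_infinity: "Im b \<ge> 0 \<Longrightarrow>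
     n1_factor None (Some b) (\<lambda>z. 1 / ((z - b) * (z - cnj b)))"

text \<open>
  \<open>is_GZNT Q a\<close>: \<open>a\<close> is the generalized zero of nonpositive type in a factorization
  \<open>Q = R M\<close>; for \<open>Q\<close> in the class above the factorization is unique. The identity is one of
  meromorphic functions, hence holds off a sparse set.
\<close>

definition is_GZNT :: "(complex \<Rightarrow> complex) \<Rightarrow> complex option \<Rightarrow> bool" where
  "is_GZNT Q a \<longleftrightarrow>
     (\<exists>b R M. n1_factor a b R \<and> nevanlinna M \<and> (\<forall>\<^sub>\<approx>z\<in>upper_half_plane. Q z = R z * M z))"

fun Q_transform :: "(complex \<Rightarrow> complex) \<Rightarrow> real option \<Rightarrow> complex \<Rightarrow> complex" where
  "Q_transform Q (Some \<tau>) = (\<lambda>z. (Q z - of_real \<tau>) / (1 + of_real \<tau> * Q z))"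
| "Q_transform Q None = (\<lambda>z. - 1 / Q z)"

definition extended_real_line :: "real option topology" where
  "extended_real_line = Alexandroff_compactification euclidean"

definition riemann_sphere :: "complex option topology" where
  "riemann_sphere = Alexandroff_compactification euclidean"

end

theory Submission
  imports Defs
begin

text \<open>
  For a point \<open>a\<close> of the closed upper half-plane let \<open>p\<^sub>a(z) = (z - a) * (z - cnj a) / (1 + |a|\<^sup>2)\<close>,
  and let \<open>p\<^sub>\<infinity> = 1\<close>. That \<open>a\<close> is a generalized zero of \<open>Q\<^sub>\<tau>\<close> means that
  \<open>Q\<^sub>\<tau> = M * p\<^sub>a / p\<^sub>b\<close> for some \<open>b\<close> and some \<open>M\<close> that is holomorphic with nonnegative imaginary part
  on the upper half-plane. Multiplication by \<open>|p\<^sub>a|\<^sup>2\<close> and by squared denominators turns this into the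
  inequality \<open>Im (W * p\<^sub>b * cnj p\<^sub>a) \<ge> 0\<close>, where \<open>W\<close> is a nonnegative multiple of \<open>Q\<^sub>\<tau>\<close> that
  depends continuously on the point \<open>\<tau>\<close> of the extended line (\<open>circle_form\<close>).

  Continuity is a compactness argument. The coefficients of \<open>p\<^sub>a\<close> are affine functions of the
  stereographic coordinates of \<open>a\<close>, so the inequality is a closed condition on the triple
  \<open>(\<tau>, a, b)\<close>, and \<open>a\<close> and \<open>b\<close> range over a compact set. Projecting \<open>b\<close> away shows that the pairs
  \<open>(\<tau>, a)\<close> admitting such a \<open>b\<close> form a closed set. This set is the graph of \<open>\<alpha>\<close> as soon as the
  inequality determines \<open>a\<close>, and a function with closed graph into a compact space is continuous.

  That the inequality determines \<open>a\<close> is \<open>zero_parameter_unique\<close>. Comparing it with a given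
  factorization \<open>M * p\<^sub>a\<^sub>0 / p\<^sub>b\<^sub>0\<close> yields that \<open>M * (p\<^sub>a\<^sub>0 * p\<^sub>b) / (p\<^sub>b\<^sub>0 * p\<^sub>a)\<close>
  has nonnegative imaginary part. Near a zero or a pole in the half-plane the argument of a function
  takes all values, so the roots there must cancel. If the zero parameters are real or infinite, what remains is
  \<open>M * g\<^sup>2\<close> with a real rational function \<open>g\<close>; unless \<open>M\<close> is constant, \<open>Re g\<close> has no zero in the
  half-plane, hence constant sign, which again forces the real roots to cancel. Since \<open>a0 \<noteq> b0\<close> and
  \<open>a \<noteq> b\<close>, only \<open>a = a0\<close> is left. The cases \<open>a = b\<close> and \<open>a0 = b0\<close> are excluded because \<open>Im Q\<close>
  would be nonnegative, and then, by Pick's theorem (\<open>Pick_kernel_nonneg\<close>), no matrix of the kernel of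
  \<open>Q\<close> could have a negative eigenvalue.

  The map \<open>\<alpha>\<close> is injective (\<open>GZNT_inj\<close>): on a vertical path towards \<open>a = \<alpha>(\<tau>)\<close> the
  decay of \<open>p\<^sub>a / p\<^sub>b\<close> beats the growth of \<open>M\<close>, so \<open>Q\<^sub>\<tau>\<close> tends to \<open>0\<close> and \<open>Q\<close> tends to \<open>\<tau>\<close>. A continuous injection of the compact extended
  line, which is a circle, into the Hausdorff sphere is a homeomorphism onto its range.
\<close>

section \<open>Positivity of the Nevanlinna kernel\<close>

text \<open>
  On the circle, \<open>1 / (u - z)\<close> times the speed of the circle is a multiple of
  \<open>1 / (\<rho>\<^sup>2 - (z - c) * cnj (u - c))\<close>, and \<open>1 / (\<rho>\<^sup>2 - (u - c) * cnj (w - c))\<close> is holomorphic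
  in the disc. Cauchy's formula for the product of \<open>M\<close> with the latter function therefore writes
  the kernel of the disc as an inner product of two functions \<open>e z\<close>, \<open>e w\<close> weighted by \<open>M\<close>.
\<close>

lemma Cauchy_kernel_pairing:
  fixes M :: "complex \<Rightarrow> complex"
  assumes cont: "continuous_on (cball c \<rho>) M" and hol: "M holomorphic_on ball c \<rho>"
    and z: "norm (z - c) < \<rho>" and w: "norm (w - c) < \<rho>"
  defines "\<eta> \<equiv> \<lambda>t::real. \<rho> * exp (2 * of_real pi * \<i> * t)"
  defines "e \<equiv> \<lambda>z t. 1 / (of_real (\<rho>\<^sup>2) - (z - c) * cnj (\<eta> t))"
  shows "((\<lambda>t. M (c + \<eta> t) * of_real (\<rho>\<^sup>2) * (e z t * cnj (e w t)))
           has_integral M z / (of_real (\<rho>\<^sup>2) - (z - c) * cnj (w - c))) {0..1}"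
proof -
  have \<rho>: "\<rho> > 0" using z norm_ge_zero[of "z - c"] by linarith
  define d where "d = (\<lambda>u. of_real (\<rho>\<^sup>2) - (u - c) * cnj (w - c))"
  have d0: "d u \<noteq> 0" if "u \<in> cball c \<rho>" for u
  proof
    assume "d u = 0"
    then have "of_real (\<rho>\<^sup>2) = (u - c) * cnj (w - c)" by (simp add: d_def)
    then have "norm (complex_of_real (\<rho>\<^sup>2)) = norm (u - c) * norm (w - c)"
      by (metis complex_mod_cnj norm_mult)
    then have "\<rho>\<^sup>2 = norm (u - c) * norm (w - c)" by (simp add: norm_power)
    moreover have "norm (u - c) * norm (w - c) \<le> \<rho> * norm (w - c)"
      using that by (intro mult_right_mono) (auto simp: dist_norm norm_minus_commute)
    moreover have "\<rho> * norm (w - c) < \<rho> * \<rho>" using w \<rho> by simp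
    ultimately show False by (simp add: power2_eq_square)
  qed
  have "((\<lambda>u. (M u / d u) / (u - z)) has_contour_integral (2 * of_real pi * \<i> * (M z / d z)))
         (circlepath c \<rho>)"
  proof (rule Cauchy_integral_circlepath[OF _ _ z])
    show "continuous_on (cball c \<rho>) (\<lambda>u. M u / d u)"
      using d0 by (intro continuous_on_divide cont) (auto simp: d_def intro!: continuous_intros)
    have "(\<lambda>u. d u) holomorphic_on ball c \<rho>" by (simp add: d_def) (intro holomorphic_intros)
    then show "(\<lambda>u. M u / d u) holomorphic_on ball c \<rho>"
      using d0 by (intro holomorphic_on_divide hol) auto
  qed
  then have *: "((\<lambda>t. M (c + \<eta> t) / d (c + \<eta> t) / (c + \<eta> t - z) * (2 * of_real pi * \<i> * \<eta> t))
          has_integral (2 * of_real pi * \<i> * (M z / d z))) {0..1}"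
    unfolding has_contour_integral_def
  proof (rule has_integral_eq[rotated])
    fix t :: real assume "t \<in> {0..1}"
    then show "M (circlepath c \<rho> t) / d (circlepath c \<rho> t) / (circlepath c \<rho> t - z) *
         vector_derivative (circlepath c \<rho>) (at t within {0..1}) =
         M (c + \<eta> t) / d (c + \<eta> t) / (c + \<eta> t - z) * (2 * of_real pi * \<i> * \<eta> t)"
      by (simp add: vector_derivative_circlepath01) (simp add: circlepath \<eta>_def)
  qed
  have eta: "\<eta> t * cnj (\<eta> t) = of_real (\<rho>\<^sup>2)" for t
  proof -
    have "norm (\<eta> t) = \<rho>" using \<rho> by (simp add: \<eta>_def norm_mult)
    then show ?thesis by (metis complex_norm_square of_real_power)
  qed
  have pt: "M (c + \<eta> t) / d (c + \<eta> t) / (c + \<eta> t - z) * (2 * of_real pi * \<i> * \<eta> t)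
        = (2 * of_real pi * \<i>) * (M (c + \<eta> t) * of_real (\<rho>\<^sup>2) * (e z t * cnj (e w t)))" for t
  proof -
    have ne: "cnj (\<eta> t) \<noteq> 0" using \<rho> by (simp add: \<eta>_def)
    have 1: "e z t = 1 / (cnj (\<eta> t) * (c + \<eta> t - z))"
    proof -
      have "of_real (\<rho>\<^sup>2) - (z - c) * cnj (\<eta> t) = cnj (\<eta> t) * (c + \<eta> t - z)"
        unfolding eta[of t, symmetric] by (simp add: algebra_simps)
      then show ?thesis by (simp add: e_def)
    qed
    have 2: "cnj (e w t) = 1 / d (c + \<eta> t)"
      by (simp add: e_def d_def algebra_simps)
    have "\<eta> t * cnj (\<eta> t) * (1 / (cnj (\<eta> t) * (c + \<eta> t - z))) = \<eta> t / (c + \<eta> t - z)"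
      using ne by simp
    then have "of_real (\<rho>\<^sup>2) * (e z t * cnj (e w t)) = \<eta> t / (c + \<eta> t - z) * (1 / d (c + \<eta> t))"
      unfolding 1 2 eta[of t, symmetric] by (simp only: mult.assoc[symmetric])
    then show ?thesis by (simp only: mult.assoc) (simp only: times_divide_eq_left times_divide_eq_right mult_ac divide_divide_eq_left mult_1)
  qed
  have "((\<lambda>t. (1 / (2 * of_real pi * \<i>)) * ((2 * of_real pi * \<i>) * (M (c + \<eta> t) * of_real (\<rho>\<^sup>2) * (e z t * cnj (e w t)))))
          has_integral (1 / (2 * of_real pi * \<i>)) * (2 * of_real pi * \<i> * (M z / d z))) {0..1}"
    using * unfolding pt by (rule has_integral_mult_right)
  then show ?thesis by (simp add: d_def)
qed

text \<open>
  Subtracting from the pairing its conjugate with the two points exchanged leaves the weight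
  \<open>2 * Im M\<close>, so the quadratic form is the integral of \<open>Im M\<close> against the square of a norm.
\<close>

lemma Pick_kernel_disc:
  fixes M :: "complex \<Rightarrow> complex" and x c :: "'i \<Rightarrow> complex"
  assumes cont: "continuous_on (cball p \<rho>) M" and hol: "M holomorphic_on ball p \<rho>"
    and Im: "\<And>u. u \<in> cball p \<rho> \<Longrightarrow> Im (M u) \<ge> 0"
    and x: "\<And>i. i \<in> I \<Longrightarrow> norm (x i - p) < \<rho>" and I: "finite I"
  shows "Re (\<Sum>i\<in>I. \<Sum>j\<in>I. c i * cnj (c j) * ((M (x i) - cnj (M (x j))) /
            (\<i> * (of_real (\<rho>\<^sup>2) - (x i - p) * cnj (x j - p))))) \<ge> 0"
proof (cases "I = {}")
  case False
  then obtain i0 where "i0 \<in> I" by auto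
  then have \<rho>: "\<rho> > 0" using x[of i0] norm_ge_zero[of "x i0 - p"] by linarith
  define \<eta> where "\<eta> = (\<lambda>t::real. \<rho> * exp (2 * of_real pi * \<i> * t))"
  define e where "e = (\<lambda>z t. 1 / (of_real (\<rho>\<^sup>2) - (z - p) * cnj (\<eta> t)))"
  define D where "D = (\<lambda>z w. of_real (\<rho>\<^sup>2) - (z - p) * cnj (w - p))"
  \<comment> \<open>The weight of the integral is now real and nonnegative.\<close>
  have pair: "((\<lambda>t. (2 * of_real (Im (M (p + \<eta> t)))) * of_real (\<rho>\<^sup>2) * (e z t * cnj (e w t)))
           has_integral (M z - cnj (M w)) / (\<i> * D z w)) {0..1}"
    if z: "norm (z - p) < \<rho>" and w: "norm (w - p) < \<rho>" for z w
  proof -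
    have 1: "((\<lambda>t. M (p + \<eta> t) * of_real (\<rho>\<^sup>2) * (e z t * cnj (e w t)))
           has_integral M z / D z w) {0..1}"
      unfolding \<eta>_def e_def D_def by (rule Cauchy_kernel_pairing[OF cont hol z w])
    have 2: "((\<lambda>t. M (p + \<eta> t) * of_real (\<rho>\<^sup>2) * (e w t * cnj (e z t)))
           has_integral M w / D w z) {0..1}"
      unfolding \<eta>_def e_def D_def by (rule Cauchy_kernel_pairing[OF cont hol w z])
    have 3: "((\<lambda>t. cnj (M (p + \<eta> t) * of_real (\<rho>\<^sup>2) * (e w t * cnj (e z t))))
           has_integral cnj (M w / D w z)) {0..1}"
      using has_integral_linear[OF 2 bounded_linear_cnj] by (simp add: o_def)
    have 4: "cnj (M w / D w z) = cnj (M w) / D z w" by (simp add: D_def mult.commute)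
    have "((\<lambda>t. (M (p + \<eta> t) * of_real (\<rho>\<^sup>2) * (e z t * cnj (e w t)) -
             cnj (M (p + \<eta> t) * of_real (\<rho>\<^sup>2) * (e w t * cnj (e z t)))) * (1 / \<i>))
           has_integral (M z / D z w - cnj (M w) / D z w) * (1 / \<i>)) {0..1}"
      using has_integral_diff[OF 1 3] unfolding 4 by (rule has_integral_mult_left)
    moreover have "(M (p + \<eta> t) * of_real (\<rho>\<^sup>2) * (e z t * cnj (e w t)) -
             cnj (M (p + \<eta> t) * of_real (\<rho>\<^sup>2) * (e w t * cnj (e z t)))) * (1 / \<i>) =
            (2 * of_real (Im (M (p + \<eta> t)))) * of_real (\<rho>\<^sup>2) * (e z t * cnj (e w t))" for t
    proof -
      have "2 * of_real (Im (M (p + \<eta> t))) = (M (p + \<eta> t) - cnj (M (p + \<eta> t))) * (1 / \<i>)"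
        by (simp add: complex_eq_iff)
      moreover have "cnj (M (p + \<eta> t) * of_real (\<rho>\<^sup>2) * (e w t * cnj (e z t))) =
          cnj (M (p + \<eta> t)) * of_real (\<rho>\<^sup>2) * (e z t * cnj (e w t))"
        by (simp only: complex_cnj_mult complex_cnj_cnj complex_cnj_complex_of_real mult_ac)
      ultimately show ?thesis
        by (simp only: left_diff_distrib right_diff_distrib mult_ac)
    qed
    moreover have "(M z / D z w - cnj (M w) / D z w) * (1 / \<i>) = (M z - cnj (M w)) / (\<i> * D z w)"
      by (simp only: diff_divide_distrib[symmetric] times_divide_times_eq mult_1_right mult_1 mult.commute)
    ultimately show ?thesis by (simp only:)
  qed
  have "((\<lambda>t. \<Sum>i\<in>I. \<Sum>j\<in>I. c i * cnj (c j) *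
            ((2 * of_real (Im (M (p + \<eta> t)))) * of_real (\<rho>\<^sup>2) * (e (x i) t * cnj (e (x j) t))))
         has_integral (\<Sum>i\<in>I. \<Sum>j\<in>I. c i * cnj (c j) * ((M (x i) - cnj (M (x j))) / (\<i> * D (x i) (x j))))) {0..1}"
    by (intro has_integral_sum I has_integral_mult_right pair x)
  moreover have "(\<Sum>i\<in>I. \<Sum>j\<in>I. c i * cnj (c j) *
            ((2 * of_real (Im (M (p + \<eta> t)))) * of_real (\<rho>\<^sup>2) * (e (x i) t * cnj (e (x j) t))))
       = of_real (2 * Im (M (p + \<eta> t)) * \<rho>\<^sup>2 * (norm (\<Sum>i\<in>I. c i * e (x i) t))\<^sup>2)" for t
  proof -
    have "of_real ((norm (\<Sum>i\<in>I. c i * e (x i) t))\<^sup>2) = (\<Sum>i\<in>I. c i * e (x i) t) * cnj (\<Sum>i\<in>I. c i * e (x i) t)"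
      by (metis complex_norm_square of_real_power)
    also have "\<dots> = (\<Sum>i\<in>I. \<Sum>j\<in>I. (c i * e (x i) t) * cnj (c j * e (x j) t))"
      by (simp add: sum_product)
    finally show ?thesis
      by (simp add: sum_distrib_left mult_ac)
  qed
  ultimately have int: "((\<lambda>t. complex_of_real (2 * Im (M (p + \<eta> t)) * \<rho>\<^sup>2 * (norm (\<Sum>i\<in>I. c i * e (x i) t))\<^sup>2))
         has_integral (\<Sum>i\<in>I. \<Sum>j\<in>I. c i * cnj (c j) * ((M (x i) - cnj (M (x j))) / (\<i> * D (x i) (x j))))) {0..1}"
    by simp
  have "p + \<eta> t \<in> cball p \<rho>" for t
    using \<rho> by (simp add: \<eta>_def dist_norm norm_mult)
  then have "Re (\<Sum>i\<in>I. \<Sum>j\<in>I. c i * cnj (c j) * ((M (x i) - cnj (M (x j))) / (\<i> * D (x i) (x j)))) \<ge> 0"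
    using has_integral_nonneg[OF has_integral_Re[OF int]] Im by simp
  then show ?thesis by (simp add: D_def)
qed simp

text \<open>
  Pick's theorem for the half-plane, obtained by exhausting it with discs: the rescaled kernels of
  the discs converge to the Nevanlinna kernel.
\<close>

lemma Pick_kernel_nonneg:
  fixes M :: "complex \<Rightarrow> complex" and x c :: "'i \<Rightarrow> complex"
  assumes hol: "M holomorphic_on upper_half_plane" and Im: "\<And>z. Im z > 0 \<Longrightarrow> Im (M z) \<ge> 0"
    and I: "finite I" and x: "\<And>i. i \<in> I \<Longrightarrow> Im (x i) > 0"
  shows "Re (\<Sum>i\<in>I. \<Sum>j\<in>I. c i * cnj (c j) * nevanlinna_kernel M (x i) (x j)) \<ge> 0"
proof -
  \<comment> \<open>The disc of radius \<open>n\<close> about \<open>\<i> (n + 1/n)\<close> keeps distance \<open>1/n\<close> from the real line, and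
    every point of the half-plane lies in all but finitely many of these discs.\<close>
  define p where "p = (\<lambda>n::nat. \<i> * of_real (real n + 1 / real n))"
  define D where "D = (\<lambda>n z w. \<i> * (of_real ((real n)\<^sup>2) - (z - p n) * cnj (w - p n)))"
  define S where "S = (\<lambda>n. Re (\<Sum>i\<in>I. \<Sum>j\<in>I. c i * cnj (c j) * ((M (x i) - cnj (M (x j))) / (D n (x i) (x j) / of_nat n))))"
  have inv: "(\<lambda>n. 1 / real n) \<longlonglongrightarrow> 0" by (simp add: lim_1_over_n)
  have inv': "(\<lambda>n. 1 / of_nat n :: complex) \<longlonglongrightarrow> 0"
    using tendsto_of_real[OF inv, where ?'a = complex] by simp
  have limD: "(\<lambda>n. D n z w / of_nat n) \<longlonglongrightarrow> z - cnj w" for z w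
  proof -
    have "(\<lambda>n. (1 + (1 / of_nat n)\<^sup>2) * (z - cnj w) - \<i> * (z * cnj w + 2 + (1 / of_nat n)\<^sup>2) * (1 / of_nat n))
       \<longlonglongrightarrow> (1 + 0\<^sup>2) * (z - cnj w) - \<i> * (z * cnj w + 2 + 0\<^sup>2) * 0"
      by (intro tendsto_intros inv')
    moreover have "(1 + (1 / of_nat n)\<^sup>2) * (z - cnj w) - \<i> * (z * cnj w + 2 + (1 / of_nat n)\<^sup>2) * (1 / of_nat n) = D n z w / of_nat n"
      if "n > 0" for n
      using that by (simp add: D_def p_def field_simps power2_eq_square)
    then have "eventually (\<lambda>n. (1 + (1 / of_nat n)\<^sup>2) * (z - cnj w) - \<i> * (z * cnj w + 2 + (1 / of_nat n)\<^sup>2) * (1 / of_nat n) = D n z w / of_nat n) sequentially"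
      by (intro eventually_mono[OF eventually_gt_at_top[of 0]])
    ultimately show ?thesis by (simp add: Lim_transform_eventually)
  qed
  have "S \<longlonglongrightarrow> Re (\<Sum>i\<in>I. \<Sum>j\<in>I. c i * cnj (c j) * ((M (x i) - cnj (M (x j))) / (x i - cnj (x j))))"
    unfolding S_def
  proof (intro tendsto_intros limD)
    fix i j assume "i \<in> I" "j \<in> I"
    then have "Im (x i - cnj (x j)) > 0" using x[of i] x[of j] by simp
    then show "x i - cnj (x j) \<noteq> 0" by auto
  qed
  moreover have "eventually (\<lambda>n. S n \<ge> 0) sequentially"
  proof -
    have near: "eventually (\<lambda>n. norm (z - p n) < real n) sequentially" if z: "Im z > 0" for z
    proof -
      have "(\<lambda>n. Re (D n z z / of_nat n / \<i>)) \<longlonglongrightarrow> Re ((z - cnj z) / \<i>)"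
        by (intro tendsto_intros limD) auto
      moreover have "Re ((z - cnj z) / \<i>) > 0" using z by simp
      ultimately have "eventually (\<lambda>n. Re (D n z z / of_nat n / \<i>) > 0) sequentially"
        by (rule order_tendstoD)
      then show ?thesis
        using eventually_gt_at_top[of 0]
      proof eventually_elim
        case (elim n)
        have "D n z z / of_nat n / \<i> = of_real (((real n)\<^sup>2 - (norm (z - p n))\<^sup>2) / real n)"
          by (simp add: D_def complex_norm_square flip: of_real_power)
        then have "((real n)\<^sup>2 - (norm (z - p n))\<^sup>2) / real n > 0"
          using elim by (metis Re_complex_of_real)
        then have "(norm (z - p n))\<^sup>2 < (real n)\<^sup>2" using elim by (simp add: zero_less_divide_iff)
        then show ?case by (rule power2_less_imp_less) simp
      qed
    qed
    have "eventually (\<lambda>n. \<forall>i\<in>I. norm (x i - p n) < real n) sequentially"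
      using I by (simp add: eventually_ball_finite_distrib near x)
    then show ?thesis using eventually_gt_at_top[of 0]
    proof eventually_elim
      case (elim n)
      have sub: "cball (p n) (real n) \<subseteq> upper_half_plane"
      proof
        fix u assume "u \<in> cball (p n) (real n)"
        then have "\<bar>real n + 1 / real n - Im u\<bar> \<le> real n"
          using abs_Im_le_cmod[of "p n - u"] by (simp add: dist_norm p_def)
        moreover have "1 / real n > 0" using elim by simp
        ultimately have "Im u > 0" by arith
        then show "u \<in> upper_half_plane" by simp
      qed
      have "0 \<le> real n * Re (\<Sum>i\<in>I. \<Sum>j\<in>I. c i * cnj (c j) * ((M (x i) - cnj (M (x j))) / D n (x i) (x j)))"
        unfolding D_def
      proof (intro mult_nonneg_nonneg Pick_kernel_disc)
        show "continuous_on (cball (p n) (real n)) M" 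
          using sub hol holomorphic_on_imp_continuous_on continuous_on_subset by blast
        show "M holomorphic_on ball (p n) (real n)"
          using sub hol by (meson ball_subset_cball holomorphic_on_subset subset_trans)
      qed (use elim sub Im I in auto)
      also have "\<dots> = S n"
      proof -
        have n: "real n * Re w = Re (of_nat n * w)" for w by simp
        show ?thesis unfolding S_def n
          by (simp only: sum_distrib_left divide_divide_eq_right times_divide_eq_right mult_ac)
      qed
      finally show ?case .
    qed
  qed
  ultimately show ?thesis
    unfolding nevanlinna_kernel_def by (rule tendsto_lowerbound) simp
qed

text \<open>
  A negative eigenvalue would make the quadratic form negative at the conjugate of its eigenvector.
\<close>

lemma num_neg_eigenvalues_eq_0:
  assumes A: "A \<in> carrier_mat n n"
    and pos: "\<And>v. Re (\<Sum>i<n. \<Sum>j<n. v i * cnj (v j) * A $$ (i, j)) \<ge> 0"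
  shows "num_neg_eigenvalues A = 0"
proof -
  have "\<not> Re \<mu> < 0" if \<mu>: "poly (char_poly A) \<mu> = 0" "\<mu> \<in> \<real>" for \<mu>
  proof
    assume neg: "Re \<mu> < 0"
    from \<mu>(1) obtain v where "eigenvector A v \<mu>"
      using eigenvalue_root_char_poly[OF A] by (auto simp: eigenvalue_def)
    then have v: "v \<in> carrier_vec n" "v \<noteq> 0\<^sub>v n" "A *\<^sub>v v = \<mu> \<cdot>\<^sub>v v"
      using A by (auto simp: eigenvector_def)
    let ?v = "\<lambda>i. vec_index v i"
    have row: "(\<Sum>j<n. A $$ (i, j) * ?v j) = \<mu> * ?v i" if i: "i < n" for i
    proof -
      have "vec_index (A *\<^sub>v v) i = (\<Sum>j<n. A $$ (i, j) * ?v j)"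
        using i A v(1) by (auto simp: scalar_prod_def atLeast0LessThan intro!: sum.cong)
      then show ?thesis using v i by simp
    qed
    have "(\<Sum>i<n. \<Sum>j<n. cnj (?v i) * cnj (cnj (?v j)) * A $$ (i, j)) = (\<Sum>i<n. cnj (?v i) * (\<Sum>j<n. A $$ (i, j) * ?v j))"
      by (simp add: sum_distrib_left mult_ac)
    also have "\<dots> = (\<Sum>i<n. \<mu> * of_real ((norm (?v i))\<^sup>2))"
    proof (rule sum.cong)
      fix i assume "i \<in> {..<n}"
      then have "cnj (?v i) * (\<Sum>j<n. A $$ (i, j) * ?v j) = \<mu> * (?v i * cnj (?v i))"
        using row[of i] by (simp only: lessThan_iff) (simp add: mult_ac)
      then show "cnj (?v i) * (\<Sum>j<n. A $$ (i, j) * ?v j) = \<mu> * of_real ((norm (?v i))\<^sup>2)"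
        by (simp only: complex_norm_square)
    qed simp
    also have "\<dots> = \<mu> * of_real (\<Sum>i<n. (norm (?v i))\<^sup>2)"
      by (simp add: sum_distrib_left)
    finally have QF: "(\<Sum>i<n. \<Sum>j<n. cnj (?v i) * cnj (cnj (?v j)) * A $$ (i, j)) =
       \<mu> * of_real (\<Sum>i<n. (norm (?v i))\<^sup>2)" .
    have "Re (\<mu> * of_real r) = Re \<mu> * r" for r by simp
    then have "Re \<mu> * (\<Sum>i<n. (norm (?v i))\<^sup>2) \<ge> 0"
      using pos[of "\<lambda>i. cnj (?v i)"] unfolding QF by simp
    moreover have "(\<Sum>i<n. (norm (?v i))\<^sup>2) > 0"
    proof -
      obtain i where "i < n" "?v i \<noteq> 0" using v(1,2) by (metis eq_vecI carrier_vecD index_zero_vec)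
      then show ?thesis by (intro sum_pos2[of _ i]) auto
    qed
    ultimately show False using neg by (simp add: zero_le_mult_iff)
  qed
  moreover have "char_poly A \<noteq> 0" using degree_monic_char_poly[OF A] by auto
  ultimately have "{#\<mu> \<in># proots (char_poly A). \<mu> \<in> \<real> \<and> Re \<mu> < 0#} = {#}"
    by auto
  then show ?thesis by (simp add: num_neg_eigenvalues_def)
qed

section \<open>Orders of vanishing under a sign condition\<close>

text \<open>
  Along the ray with angle \<open>\<theta>\<close> the two powers contribute a positive factor and the constant phase
  \<open>(m - n) * \<theta>\<close>, which survives in the limit.
\<close>

lemma Im_nonneg_along_ray:
  fixes f :: "complex \<Rightarrow> complex"
  assumes f: "isCont f z0"
    and nonneg: "eventually (\<lambda>\<epsilon>. Im (f (z0 + of_real \<epsilon> * cis \<theta>) *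
                  (of_real \<epsilon> * cis \<theta>) ^ m * cnj ((of_real \<epsilon> * cis \<theta>) ^ n)) \<ge> 0) (at_right 0)"
  shows "Im (f z0 * cis (of_int (int m - int n) * \<theta>)) \<ge> 0"
proof -
  have "((\<lambda>\<epsilon>. z0 + of_real \<epsilon> * cis \<theta>) \<longlongrightarrow> z0 + of_real 0 * cis \<theta>) (at_right 0)"
    by (intro tendsto_intros)
  then have "((\<lambda>\<epsilon>. f (z0 + of_real \<epsilon> * cis \<theta>)) \<longlongrightarrow> f z0) (at_right 0)"
    using isCont_tendsto_compose[OF f] by simp
  then have "((\<lambda>\<epsilon>. Im (f (z0 + of_real \<epsilon> * cis \<theta>) * cis (of_int (int m - int n) * \<theta>)))
      \<longlongrightarrow> Im (f z0 * cis (of_int (int m - int n) * \<theta>))) (at_right 0)"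
    by (intro tendsto_intros)
  moreover have "eventually (\<lambda>\<epsilon>. Im (f (z0 + of_real \<epsilon> * cis \<theta>) * cis (of_int (int m - int n) * \<theta>)) \<ge> 0) (at_right 0)"
    using nonneg eventually_at_right_less[of 0]
  proof eventually_elim
    case (elim \<epsilon>)
    have cs: "cis \<theta> ^ m * cnj (cis \<theta> ^ n) = cis (of_int (int m - int n) * \<theta>)"
      by (simp add: Complex.DeMoivre cis_cnj cis_mult algebra_simps)
    have "f (z0 + of_real \<epsilon> * cis \<theta>) * (of_real \<epsilon> * cis \<theta>) ^ m * cnj ((of_real \<epsilon> * cis \<theta>) ^ n)
       = of_real (\<epsilon> ^ (m + n)) * (f (z0 + of_real \<epsilon> * cis \<theta>) * cis (of_int (int m - int n) * \<theta>))"
      unfolding cs[symmetric] by (simp only: power_mult_distrib power_add mult_ac complex_cnj_mult complex_cnj_power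
          complex_cnj_complex_of_real of_real_mult of_real_power)
    moreover have "Im (of_real r * y) = r * Im y" for r y by simp
    ultimately have "\<epsilon> ^ (m + n) * Im (f (z0 + of_real \<epsilon> * cis \<theta>) * cis (of_int (int m - int n) * \<theta>)) \<ge> 0"
      using elim(1) by (simp only:)
    then show ?case using zero_less_power[OF elim(2), of "m + n"]
      by (metis linorder_not_le zero_le_mult_iff)
  qed
  ultimately show ?thesis
    by (rule tendsto_lowerbound) simp
qed

text \<open>
  If \<open>m\<close> and \<open>n\<close> differ, the phase \<open>(m - n) * \<theta>\<close> takes every value as \<open>\<theta>\<close> varies, so on some ray
  the expression points in the direction of \<open>-\<i>\<close>. This single observation excludes zeros and poles of
  functions with nonnegative imaginary part, and it balances the roots in the interior.
\<close>

lemma orders_eq_interior: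
  fixes f :: "complex \<Rightarrow> complex"
  assumes f: "isCont f z0" "f z0 \<noteq> 0"
    and nonneg: "eventually (\<lambda>z. Im (f z * (z - z0) ^ m * cnj ((z - z0) ^ n)) \<ge> 0) (at z0)"
  shows "m = n"
proof (rule ccontr)
  assume "m \<noteq> n"
  define k where "k = real_of_int (int m - int n)"
  have k: "k \<noteq> 0" using \<open>m \<noteq> n\<close> by (simp add: k_def)
  \<comment> \<open>The direction in which the limit is a positive multiple of \<open>-\<i>\<close>.\<close>
  define \<theta> where "\<theta> = (- pi / 2 - Arg (f z0)) / k"
  have "filterlim (\<lambda>\<epsilon>. z0 + of_real \<epsilon> * cis \<theta>) (at z0) (at_right 0)"
    unfolding filterlim_at
  proof
    show "eventually (\<lambda>\<epsilon>. z0 + of_real \<epsilon> * cis \<theta> \<in> UNIV \<and> z0 + of_real \<epsilon> * cis \<theta> \<noteq> z0) (at_right 0)"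
      by (rule eventually_mono[OF eventually_at_right_less[of 0]]) auto
    have "((\<lambda>\<epsilon>. z0 + of_real \<epsilon> * cis \<theta>) \<longlongrightarrow> z0 + of_real 0 * cis \<theta>) (at_right 0)"
      by (intro tendsto_intros)
    then show "((\<lambda>\<epsilon>. z0 + of_real \<epsilon> * cis \<theta>) \<longlongrightarrow> z0) (at_right 0)" by simp
  qed
  from eventually_compose_filterlim[OF nonneg this]
  have "Im (f z0 * cis (of_int (int m - int n) * \<theta>)) \<ge> 0"
    by (intro Im_nonneg_along_ray f) simp
  moreover have "of_int (int m - int n) * \<theta> = - pi / 2 - Arg (f z0)"
    using k unfolding k_def[symmetric] by (simp add: \<theta>_def)
  moreover have *: "f z0 * cis (- pi / 2 - Arg (f z0)) = of_real (norm (f z0)) * (- \<i>)"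
  proof -
    have "f z0 = of_real (norm (f z0)) * cis (Arg (f z0))"
      using rcis_cmod_Arg[of "f z0"] by (simp add: rcis_def)
    then have "f z0 * cis (- pi / 2 - Arg (f z0)) = of_real (norm (f z0)) * (cis (Arg (f z0)) * cis (- pi / 2 - Arg (f z0)))"
      by (metis mult.assoc)
    also have "\<dots> = of_real (norm (f z0)) * (- \<i>)"
      by (simp add: cis_mult complex_eq_iff)
    finally show ?thesis .
  qed
  ultimately have "Im (of_real (norm (f z0)) * (- \<i>)) \<ge> 0" by (simp only:)
  then show False using f(2) by simp
qed

text \<open>
  At a boundary point only the angles between \<open>0\<close> and \<open>\<pi>\<close> are available. They still suffice when
  \<open>f\<close> is imaginary at the point, since the cosine changes sign before \<open>\<pi>\<close>, and when \<open>f\<close> is real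
  and the difference of the orders is even, hence at least \<open>2\<close> in modulus, since then the phase
  sweeps out an interval of length \<open>2 * \<pi>\<close>.
\<close>

lemma orders_eq_boundary:
  fixes f :: "complex \<Rightarrow> complex" and x0 :: real
  assumes f: "isCont f x0" "f x0 \<noteq> 0" "f x0 \<in> \<real> \<or> \<i> * f x0 \<in> \<real>"
    and nonneg: "\<And>z. Im z > 0 \<Longrightarrow> Im (f z * (z - x0) ^ m * cnj ((z - x0) ^ n)) \<ge> 0"
    and im: "f x0 \<in> \<real> \<Longrightarrow> even (m + n)"
  shows "m = n"
proof (rule ccontr)
  assume "m \<noteq> n"
  define k where "k = real_of_int (int m - int n)"
  have k1: "\<bar>k\<bar> \<ge> 1" using \<open>m \<noteq> n\<close> by (simp add: k_def flip: of_int_abs)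
  have ray: "Im (f x0 * cis (k * \<theta>)) \<ge> 0" if "0 < \<theta>" "\<theta> < pi" for \<theta>
    unfolding k_def
  proof (rule Im_nonneg_along_ray[OF f(1)], rule eventually_mono[OF eventually_at_right_less[of 0]])
    fix \<epsilon> :: real assume "\<epsilon> > 0"
    then have "Im (x0 + of_real \<epsilon> * cis \<theta>) > 0" using that by (simp add: sin_gt_zero)
    from nonneg[OF this] show "Im (f (x0 + of_real \<epsilon> * cis \<theta>) *
        (of_real \<epsilon> * cis \<theta>) ^ m * cnj ((of_real \<epsilon> * cis \<theta>) ^ n)) \<ge> 0" by simp
  qed
  \<comment> \<open>Reparametrize by the phase \<open>\<phi> = \<bar>k\<bar> * \<theta>\<close> itself.\<close>
  have bd: "0 < \<phi> / \<bar>k\<bar> \<and> \<phi> / \<bar>k\<bar> < pi" if "0 < \<phi>" "\<phi> < pi * \<bar>k\<bar>" for \<phi>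
    using that k1 by (simp add: field_simps)
  have ray': "Im (f x0 * cis (sgn k * \<phi>)) \<ge> 0" if "0 < \<phi>" "\<phi> < pi * \<bar>k\<bar>" for \<phi>
  proof -
    have "k * (\<phi> / \<bar>k\<bar>) = sgn k * \<phi>" using k1 by (simp add: sgn_if)
    then show ?thesis using ray[of "\<phi> / \<bar>k\<bar>"] bd[OF that] by simp
  qed
  have sg: "sgn k = 1 \<or> sgn k = -1" using k1 by (auto simp: sgn_if)
  have pik: "pi \<le> pi * \<bar>k\<bar>" using k1 by simp
  show False
  proof (cases "f x0 \<in> \<real>")
    case True
    then have "even (m + n)" by (rule im)
    then have "even (int m - int n)" by presburger
    moreover have "int m - int n \<noteq> 0" using \<open>m \<noteq> n\<close> by simp
    ultimately have "\<bar>int m - int n\<bar> \<ge> 2" by presburger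
    then have "\<bar>k\<bar> \<ge> 2" unfolding k_def of_int_abs[symmetric] by linarith
    then have "2 * pi \<le> pi * \<bar>k\<bar>" by simp
    then have "pi / 2 < pi * \<bar>k\<bar>" "3 * pi / 2 < pi * \<bar>k\<bar>" using pi_gt_zero by linarith+
    moreover have "sin (3 * pi / 2) = -1"
      using sin_3over2_pi by simp
    ultimately show False using ray'[of "pi / 2"] ray'[of "3 * pi / 2"] True f(2) sg
      by (auto simp: complex_is_Real_iff complex_eq_iff)
  next
    case False
    then have Re: "Re (f x0) = 0" and "Im (f x0) \<noteq> 0" using f by (auto simp: complex_is_Real_iff complex_eq_iff)
    moreover have "pi / 4 < pi * \<bar>k\<bar>" "3 * pi / 4 < pi * \<bar>k\<bar>" using pik pi_gt_zero by linarith+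
    moreover have "cos (pi / 4) > 0" by (simp add: cos_45)
    moreover have "cos (3 * pi / 4) < 0"
    proof -
      have "cos (3 * pi / 4) = - cos (pi / 4)" 
      proof -
        have "3 * pi / 4 = pi - pi / 4" by simp
        then show ?thesis by (simp only: cos_pi_minus)
      qed
      then show ?thesis by (simp add: cos_45)
    qed
    ultimately show False using ray'[of "pi / 4"] ray'[of "3 * pi / 4"] sg
      by (auto simp: zero_le_mult_iff)
  qed
qed

section \<open>Uniqueness of the zero parameter\<close>

lemma upper_half_plane_topology:
  "open upper_half_plane" "connected upper_half_plane"
  by (simp_all add: open_halfspace_Im_gt convex_connected convex_halfspace_Im_gt)

lemma holomorphic_on_open_imp_isCont:
  assumes "f holomorphic_on S" "open S" "z \<in> S"
  shows "isCont f z"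
  using assms holomorphic_on_imp_continuous_on continuous_on_eq_continuous_at by blast

text \<open>
  A form of the open mapping theorem: at a real value \<open>M z0\<close> the function \<open>M - M z0\<close> would have a
  zero of positive order, which its sign condition forbids.
\<close>

lemma Im_nonneg_imp_constant:
  assumes hol: "M holomorphic_on upper_half_plane" and Im: "\<And>z. Im z > 0 \<Longrightarrow> Im (M z) \<ge> 0"
    and z0: "Im z0 > 0" "Im (M z0) = 0" and z: "Im z > 0"
  shows "M z = M z0"
proof (rule ccontr)
  assume ne: "M z \<noteq> M z0"
  define f where "f = (\<lambda>z. M z - M z0)"
  have "\<not> f constant_on upper_half_plane"
  proof
    assume "f constant_on upper_half_plane"
    then obtain c where "\<And>w. Im w > 0 \<Longrightarrow> f w = c" by (auto simp: constant_on_def)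
    then have "f z = f z0" using z z0 by simp
    then show False using ne by (simp add: f_def)
  qed
  moreover have "f holomorphic_on upper_half_plane"
    unfolding f_def by (intro holomorphic_intros hol)
  moreover have "f z0 = 0" "z0 \<in> upper_half_plane" using z0 by (simp_all add: f_def)
  ultimately obtain g r n where g: "0 < n" "0 < r" "ball z0 r \<subseteq> upper_half_plane"
      "g holomorphic_on ball z0 r" "\<And>w. w \<in> ball z0 r \<Longrightarrow> f w = (w - z0) ^ n * g w"
      "\<And>w. w \<in> ball z0 r \<Longrightarrow> g w \<noteq> 0"
    using holomorphic_factor_zero_nonconstant[of f upper_half_plane z0] upper_half_plane_topology
    by (metis (lifting))
  have "n = 0"
  proof (rule orders_eq_interior)
    show "isCont g z0"
      using g(2,4) by (intro holomorphic_on_open_imp_isCont[of g "ball z0 r"]) auto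
    show "g z0 \<noteq> 0" using g by simp
    have "eventually (\<lambda>w. w \<in> ball z0 r) (at z0)"
      using g(2) by (intro eventually_at_in_open') auto
    then show "eventually (\<lambda>w. Im (g w * (w - z0) ^ n * cnj ((w - z0) ^ 0)) \<ge> 0) (at z0)"
    proof eventually_elim
      case (elim w)
      have "g w * (w - z0) ^ n * cnj ((w - z0) ^ 0) = f w" using g(5)[OF elim] by simp
      moreover have "Im w > 0" using elim g(3) by auto
      ultimately show ?case using Im[of w] z0 by (simp add: f_def)
    qed
  qed
  then show False using g(1) by simp
qed

definition closed_upper_sphere :: "complex option set" where
  "closed_upper_sphere = insert None (Some ` {w. Im w \<ge> 0})"

text \<open>
  The quadratic polynomial with roots \<open>a\<close> and \<open>cnj a\<close>. The normalization makes it converge to the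
  constant \<open>1\<close> as \<open>a\<close> tends to infinity, so that the three kinds of rational factors become one:
  each is a positive multiple of \<open>root_form a / root_form b\<close>.
\<close>

primrec root_form :: "complex option \<Rightarrow> complex \<Rightarrow> complex" where
  "root_form None = (\<lambda>z. 1)"
| "root_form (Some a) = (\<lambda>z. (z - a) * (z - cnj a) / of_real (1 + (norm a)\<^sup>2))"

definition root_count :: "complex \<Rightarrow> complex option \<Rightarrow> nat" where
  "root_count z a = (if a = Some z then 1 else 0)"

lemma one_plus_square_neq_0 [simp]: "1 + r\<^sup>2 \<noteq> (0::real)"
  using zero_le_power2[of r] by linarith

lemma one_plus_norm_square_neq_0 [simp]: "1 + (complex_of_real (norm a))\<^sup>2 \<noteq> 0"
proof -
  have "1 + (norm a)\<^sup>2 > 0" by (simp add: add_pos_nonneg)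
  then have "complex_of_real (1 + (norm a)\<^sup>2) \<noteq> 0" by (metis less_irrefl of_real_eq_0_iff)
  then show ?thesis by simp
qed

lemma root_form_eq_0_iff:
  assumes "a \<in> closed_upper_sphere" "Im z > 0"
  shows "root_form a z = 0 \<longleftrightarrow> a = Some z"
  using assms by (cases a) (auto simp: closed_upper_sphere_def)

lemma isCont_root_form [continuous_intros]: "isCont (root_form a) z"
  by (cases a) (auto intro!: continuous_intros)

lemma root_form_factor_interior:
  assumes a: "a \<in> closed_upper_sphere" and z0: "Im z0 > 0"
  obtains e :: "complex \<Rightarrow> complex" where "isCont e z0" "e z0 \<noteq> 0" "\<And>z. root_form a z = e z * (z - z0) ^ root_count z0 a"
proof (cases "a = Some z0")
  case True
  have "z0 \<noteq> cnj z0" using z0 by (simp add: complex_eq_iff)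
  then show ?thesis using True
    by (intro that[of "\<lambda>z. (z - cnj z0) / of_real (1 + (norm z0)\<^sup>2)"])
      (auto simp: root_count_def intro!: continuous_intros)
next
  case False
  then show ?thesis using root_form_eq_0_iff[OF a z0]
    by (intro that[of "root_form a"]) (auto simp: root_count_def isCont_root_form)
qed

text \<open>
  Conjugation in \<open>nonneg\<close> stands for division, up to a positive factor: the condition says that
  \<open>M * (p\<^sub>a\<^sub>0 * p\<^sub>b) / (p\<^sub>b\<^sub>0 * p\<^sub>a)\<close> has nonnegative imaginary part, where \<open>p\<close> is the root
  form, but it makes sense at the poles as well. Such a function has neither zeros nor poles in the
  half-plane, so the roots of numerator and denominator cancel there.
\<close>

lemma interior_root_balance:
  assumes M: "isCont M z0" "M z0 \<noteq> 0" and z0: "Im z0 > 0"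
    and adm: "a0 \<in> closed_upper_sphere" "b0 \<in> closed_upper_sphere" "a \<in> closed_upper_sphere" "b \<in> closed_upper_sphere"
    and nonneg: "\<And>z. Im z > 0 \<Longrightarrow>
      Im (M z * (root_form a0 z * root_form b z) * cnj (root_form b0 z * root_form a z)) \<ge> 0"
  shows "root_count z0 a0 + root_count z0 b = root_count z0 b0 + root_count z0 a"
proof -
  obtain e1 where e1: "isCont e1 z0" "e1 z0 \<noteq> 0" "\<And>z. root_form a0 z = e1 z * (z - z0) ^ root_count z0 a0"
    using root_form_factor_interior[OF adm(1) z0] by blast
  obtain e2 where e2: "isCont e2 z0" "e2 z0 \<noteq> 0" "\<And>z. root_form b0 z = e2 z * (z - z0) ^ root_count z0 b0"
    using root_form_factor_interior[OF adm(2) z0] by blast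
  obtain e3 where e3: "isCont e3 z0" "e3 z0 \<noteq> 0" "\<And>z. root_form a z = e3 z * (z - z0) ^ root_count z0 a"
    using root_form_factor_interior[OF adm(3) z0] by blast
  obtain e4 where e4: "isCont e4 z0" "e4 z0 \<noteq> 0" "\<And>z. root_form b z = e4 z * (z - z0) ^ root_count z0 b"
    using root_form_factor_interior[OF adm(4) z0] by blast
  let ?f = "\<lambda>z. M z * (e1 z * e4 z) * cnj (e2 z * e3 z)"
  show ?thesis
  proof (rule orders_eq_interior)
    show "isCont ?f z0" by (intro continuous_intros M e1 e2 e3 e4)
    show "?f z0 \<noteq> 0" using M e1 e2 e3 e4 by simp
    have "eventually (\<lambda>z. z \<in> upper_half_plane) (at z0)"
      using z0 upper_half_plane_topology by (intro eventually_at_in_open') auto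
    then show "eventually (\<lambda>z. Im (?f z * (z - z0) ^ (root_count z0 a0 + root_count z0 b) *
         cnj ((z - z0) ^ (root_count z0 b0 + root_count z0 a))) \<ge> 0) (at z0)"
    proof eventually_elim
      case (elim z)
      have "?f z * (z - z0) ^ (root_count z0 a0 + root_count z0 b) *
         cnj ((z - z0) ^ (root_count z0 b0 + root_count z0 a)) =
         M z * (root_form a0 z * root_form b z) * cnj (root_form b0 z * root_form a z)"
        by (simp only: e1(3) e2(3) e3(3) e4(3) power_add complex_cnj_mult mult_ac)
      then show ?case using nonneg[of z] elim by (simp only: mem_Collect_eq)
    qed
  qed
qed

text \<open>
  For real \<open>a\<close> the root form is the square of this linear function.
\<close>

primrec root_line :: "complex option \<Rightarrow> complex \<Rightarrow> complex" where
  "root_line None = (\<lambda>z. 1)"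
| "root_line (Some a) = (\<lambda>z. (z - a) / of_real (sqrt (1 + (norm a)\<^sup>2)))"

definition real_sphere :: "complex option set" where
  "real_sphere = insert None (Some ` \<real>)"

lemma root_form_eq_root_line_square:
  assumes "a \<in> real_sphere"
  shows "root_form a z = (root_line a z)\<^sup>2"
proof (cases a)
  case (Some w)
  then have "cnj w = w" using assms by (auto simp: real_sphere_def Reals_cnj_iff)
  moreover have "complex_of_real (sqrt (1 + (norm w)\<^sup>2)) * complex_of_real (sqrt (1 + (norm w)\<^sup>2)) = of_real (1 + (norm w)\<^sup>2)"
    by (simp add: add_nonneg_nonneg flip: of_real_mult)
  ultimately show ?thesis using Some by (simp add: power2_eq_square)
qed simp

lemma isCont_root_line [continuous_intros]: "isCont (root_line a) z"
  by (cases a) (auto intro!: continuous_intros)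

lemma root_line_neq_0:
  assumes "a \<in> real_sphere" "Im z > 0"
  shows "root_line a z \<noteq> 0"
  using assms by (cases a) (auto simp: real_sphere_def complex_is_Real_iff)

lemma root_line_factor_boundary:
  fixes x0 :: real
  assumes a: "a \<in> real_sphere"
  obtains e :: "complex \<Rightarrow> complex" where "isCont e x0" "e x0 \<noteq> 0" "e x0 \<in> \<real>"
    "\<And>z. root_line a z = e z * (z - x0) ^ root_count x0 a"
proof (cases "a = Some (of_real x0)")
  case True
  then show ?thesis 
    by (intro that[of "\<lambda>z. 1 / of_real (sqrt (1 + (norm (complex_of_real x0))\<^sup>2))"])
      (simp_all add: root_count_def del: norm_of_real)
next
  case False
  have "root_line a x0 \<noteq> 0"
    using False by (cases a) auto
  moreover have "root_line a x0 \<in> \<real>"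
    using a by (cases a) (auto simp: real_sphere_def)
  ultimately show ?thesis using False
    by (intro that[of "root_line a"]) (auto simp: root_count_def isCont_root_line)
qed

text \<open>
  When all four parameters are real or infinite, the quotient of root forms is, up to a positive
  factor, the square of \<open>G = l\<^sub>a\<^sub>0 * l\<^sub>b * cnj (l\<^sub>b\<^sub>0 * l\<^sub>a)\<close>, where \<open>l\<close> is the linear
  function \<open>root_line\<close>. If \<open>Im M\<close> is positive, \<open>Re G\<close> cannot vanish in the half-plane:
  otherwise \<open>G\<^sup>2\<close> would be negative and \<open>Im (M * G\<^sup>2)\<close> as well. So \<open>Re G\<close> has constant sign there,
  and since \<open>G\<close> is real on the real line, the orders of numerator and denominator at a boundary point agree.
  If \<open>M\<close> is a real constant, the same is read off from \<open>M * G\<^sup>2\<close> directly.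
\<close>

lemma boundary_root_balance:
  fixes x0 :: real
  assumes hol: "M holomorphic_on upper_half_plane" and Im: "\<And>z. Im z > 0 \<Longrightarrow> Im (M z) \<ge> 0"
    and nz: "\<And>z. Im z > 0 \<Longrightarrow> M z \<noteq> 0"
    and adm: "a0 \<in> real_sphere" "b0 \<in> real_sphere" "a \<in> real_sphere" "b \<in> real_sphere"
    and nonneg: "\<And>z. Im z > 0 \<Longrightarrow>
      Im (M z * (root_form a0 z * root_form b z) * cnj (root_form b0 z * root_form a z)) \<ge> 0"
  shows "root_count x0 a0 + root_count x0 b = root_count x0 b0 + root_count x0 a"
proof -
  obtain e1 :: "complex \<Rightarrow> complex" where e1: "isCont e1 x0" "e1 x0 \<noteq> 0" "e1 x0 \<in> \<real>" "\<And>z. root_line a0 z = e1 z * (z - x0) ^ root_count x0 a0"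
    using root_line_factor_boundary[OF adm(1), of x0] by blast
  obtain e2 :: "complex \<Rightarrow> complex" where e2: "isCont e2 x0" "e2 x0 \<noteq> 0" "e2 x0 \<in> \<real>" "\<And>z. root_line b0 z = e2 z * (z - x0) ^ root_count x0 b0"
    using root_line_factor_boundary[OF adm(2), of x0] by blast
  obtain e3 :: "complex \<Rightarrow> complex" where e3: "isCont e3 x0" "e3 x0 \<noteq> 0" "e3 x0 \<in> \<real>" "\<And>z. root_line a z = e3 z * (z - x0) ^ root_count x0 a"
    using root_line_factor_boundary[OF adm(3), of x0] by blast
  obtain e4 :: "complex \<Rightarrow> complex" where e4: "isCont e4 x0" "e4 x0 \<noteq> 0" "e4 x0 \<in> \<real>" "\<And>z. root_line b z = e4 z * (z - x0) ^ root_count x0 b"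
    using root_line_factor_boundary[OF adm(4), of x0] by blast
  define m where "m = root_count x0 a0 + root_count x0 b"
  define n where "n = root_count x0 b0 + root_count x0 a"
  define G where "G = (\<lambda>z. root_line a0 z * root_line b z * cnj (root_line b0 z * root_line a z))"
  define E where "E = (\<lambda>z. e1 z * e4 z * cnj (e2 z * e3 z))"
  have G: "G z = E z * (z - x0) ^ m * cnj ((z - x0) ^ n)" for z
    by (simp only: G_def E_def m_def n_def e1(4) e2(4) e3(4) e4(4) power_add complex_cnj_mult mult_ac)
  have E: "isCont E x0" "E x0 \<noteq> 0" "E x0 \<in> \<real>"
    using e1 e2 e3 e4 by (auto simp: E_def Reals_cnj_iff intro!: continuous_intros)
  have G0: "G z \<noteq> 0" if "Im z > 0" for z
    using root_line_neq_0[OF _ that] adm by (simp add: G_def)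
  have GG: "Im (M z * (G z)\<^sup>2) \<ge> 0" if "Im z > 0" for z
    using nonneg[OF that] adm
    by (simp add: G_def root_form_eq_root_line_square power_mult_distrib mult_ac)
  show ?thesis
  proof (cases "\<exists>z. Im z > 0 \<and> Im (M z) = 0")
    case True
    then obtain z1 where z1: "Im z1 > 0" "Im (M z1) = 0" by auto
    \<comment> \<open>\<open>M\<close> is a real constant, and \<open>M * G\<^sup>2\<close> has order \<open>2 * m\<close> against \<open>2 * n\<close>.\<close>
    have "m + m = n + n"
    proof (rule orders_eq_boundary[where f = "\<lambda>z. M z1 * (E z)\<^sup>2" and ?x0.0 = x0])
      show "isCont (\<lambda>z. M z1 * (E z)\<^sup>2) x0" by (intro continuous_intros E)
      show "M z1 * (E x0)\<^sup>2 \<noteq> 0" using E nz[OF z1(1)] by simp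
      show "M z1 * (E x0)\<^sup>2 \<in> \<real> \<or> \<i> * (M z1 * (E x0)\<^sup>2) \<in> \<real>"
        using E(3) z1 by (simp add: complex_is_Real_iff)
      fix z :: complex assume z: "Im z > 0"
      have "M z1 * (E z)\<^sup>2 * (z - x0) ^ (m + m) * cnj ((z - x0) ^ (n + n)) = M z * (G z)\<^sup>2"
      proof -
        have "M z = M z1" by (rule Im_nonneg_imp_constant[OF hol Im z1 z])
        then show ?thesis
          by (simp only: G power_add complex_cnj_mult power2_eq_square mult_ac)
      qed
      then show "Im (M z1 * (E z)\<^sup>2 * (z - x0) ^ (m + m) * cnj ((z - x0) ^ (n + n))) \<ge> 0"
        using GG[OF z] by (simp only:)
    qed simp
    then show ?thesis by (simp add: m_def n_def)
  next
    case False
    have ReG: "Re (G z) \<noteq> 0" if z: "Im z > 0" for z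
    proof
      assume "Re (G z) = 0"
      moreover define g where "g = Im (G z)"
      ultimately have Gz: "G z = \<i> * of_real g" by (simp add: complex_eq_iff)
      then have "M z * (G z)\<^sup>2 = of_real (- (g\<^sup>2)) * M z" by (simp add: power_mult_distrib)
      moreover have "Im (of_real r * y) = r * Im y" for r y by simp
      ultimately have "- (g\<^sup>2) * Im (M z) \<ge> 0" using GG[OF z] by (simp only:)
      moreover have "Im (M z) > 0" using False Im[OF z] z by force
      moreover have "g \<noteq> 0" using G0[OF z] Gz by auto
      then have "g\<^sup>2 > 0" by simp
      ultimately show False using mult_pos_pos[of "g\<^sup>2" "Im (M z)"] by linarith
    qed
    have conn: "connected ((\<lambda>z. Re (G z)) ` upper_half_plane)"
      unfolding G_def
      by (intro connected_continuous_image upper_half_plane_topology continuous_at_imp_continuous_on ballI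
          continuous_Re continuous_mult continuous_cnj isCont_root_line)
    have sgn: "(\<forall>z. Im z > 0 \<longrightarrow> Re (G z) \<ge> 0) \<or> (\<forall>z. Im z > 0 \<longrightarrow> Re (G z) \<le> 0)"
    proof (rule ccontr)
      assume "\<not> ?thesis"
      then obtain z1 z2 where z12: "Im z1 > 0" "Re (G z1) < 0" "Im z2 > 0" "Re (G z2) > 0"
        by (auto simp: not_le)
      have "0 \<in> (\<lambda>z. Re (G z)) ` upper_half_plane"
        by (rule connectedD_interval[OF conn, of "Re (G z1)" "Re (G z2)"]) (use z12 in auto)
      then obtain z where "Im z > 0" "Re (G z) = 0" by auto
      then show False using ReG by simp
    qed
    define s :: real where "s = (if \<forall>z. Im z > 0 \<longrightarrow> Re (G z) \<ge> 0 then 1 else -1)"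
    have s: "s \<noteq> 0" "s * Re (G z) \<ge> 0" if "Im z > 0" for z
      using sgn that by (auto simp: s_def)
    have s0: "s \<noteq> 0" by (simp add: s_def)
    have "m = n"
    proof (rule orders_eq_boundary[where f = "\<lambda>z. \<i> * of_real s * E z" and ?x0.0 = x0])
      show "isCont (\<lambda>z. \<i> * of_real s * E z) x0" by (intro continuous_mult continuous_const E(1))
      show "\<i> * of_real s * E x0 \<noteq> 0" using E(2) s0 by simp
      show "\<i> * of_real s * E x0 \<in> \<real> \<or> \<i> * (\<i> * of_real s * E x0) \<in> \<real>"
        using E(3) by (simp add: complex_is_Real_iff)
      show "even (m + n)" if "\<i> * of_real s * E x0 \<in> \<real>"
      proof -
        have "s * Re (E x0) = 0" using that by (simp add: complex_is_Real_iff)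
        then have "Re (E x0) = 0" using s0 by simp
        then have "E x0 = 0" using E(3) by (simp add: complex_is_Real_iff complex_eq_iff)
        then show ?thesis using E(2) by simp
      qed
      fix z :: complex assume z: "Im z > 0"
      have "\<i> * of_real s * E z * (z - x0) ^ m * cnj ((z - x0) ^ n) = \<i> * of_real s * G z"
        unfolding G by (simp only: mult_ac)
      moreover have "Im (\<i> * of_real s * G z) = s * Re (G z)" by simp
      ultimately show "Im (\<i> * of_real s * E z * (z - x0) ^ m * cnj ((z - x0) ^ n)) \<ge> 0"
        using s(2)[OF z] by (simp only:)
    qed
    then show ?thesis by (simp add: m_def n_def)
  qed
qed

lemma continuous_nonneg_at:
  fixes g :: "complex \<Rightarrow> real"
  assumes "isCont g z" "eventually (\<lambda>w. g w \<ge> 0) (at z)"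
  shows "g z \<ge> 0"
  using assms(1)[unfolded isCont_def] assms(2) by (rule tendsto_lowerbound) simp

text \<open>
  Two factorizations \<open>M * p\<^sub>a\<^sub>0 / p\<^sub>b\<^sub>0\<close> and \<open>M' * p\<^sub>a / p\<^sub>b\<close> of the same function have the same
  zero parameter. A parameter in the open half-plane is found by balancing roots there. If neither
  zero parameter lies in the open half-plane, the pole parameters agree there; they either cancel or
  are real too, and the balance at all real points determines the zero parameter, which is infinite
  exactly if no real point is a root of its form.
\<close>

lemma zero_parameter_unique:
  assumes hol: "M holomorphic_on upper_half_plane" and Im: "\<And>z. Im z > 0 \<Longrightarrow> Im (M z) \<ge> 0"
    and nz: "\<And>z. Im z > 0 \<Longrightarrow> M z \<noteq> 0"
    and adm: "a0 \<in> closed_upper_sphere" "b0 \<in> closed_upper_sphere" "a \<in> closed_upper_sphere" "b \<in> closed_upper_sphere"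
    and ne: "a0 \<noteq> b0" "a \<noteq> b"
    and nonneg: "\<And>z. Im z > 0 \<Longrightarrow>
      Im (M z * (root_form a0 z * root_form b z) * cnj (root_form b0 z * root_form a z)) \<ge> 0"
  shows "a = a0"
proof (rule ccontr)
  assume aa0: "a \<noteq> a0"
  have contM: "isCont M z" if "Im z > 0" for z
    using that by (intro holomorphic_on_open_imp_isCont[OF hol] upper_half_plane_topology) auto
  have bal: "root_count z a0 + root_count z b = root_count z b0 + root_count z a" if "Im z > 0" for z
    using that by (intro interior_root_balance[OF contM nz _ adm nonneg])
  have real: "c \<in> real_sphere" if "c \<in> closed_upper_sphere" "\<And>z. Im z > 0 \<Longrightarrow> c \<noteq> Some z" for c
    using that by (force simp: closed_upper_sphere_def real_sphere_def complex_is_Real_iff)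
  have a: "a \<in> real_sphere"
  proof (rule real[OF adm(3)])
    fix z assume "Im z > 0"
    from bal[OF this] show "a \<noteq> Some z" using ne aa0 by (auto simp: root_count_def split: if_splits)
  qed
  have a0: "a0 \<in> real_sphere"
  proof (rule real[OF adm(1)])
    fix z assume "Im z > 0"
    from bal[OF this] show "a0 \<noteq> Some z" using ne aa0 by (auto simp: root_count_def split: if_splits)
  qed
  have not: "a \<noteq> Some z" "a0 \<noteq> Some z" if "Im z > 0" for z
    using a a0 that by (auto simp: real_sphere_def complex_is_Real_iff)
  have bb: "b = Some z \<longleftrightarrow> b0 = Some z" if "Im z > 0" for z
    using bal[OF that] not[OF that] by (auto simp: root_count_def split: if_splits)
  have eqs: "root_count (of_real x) a0 = root_count (of_real x) a" for x
  proof (cases "b = b0")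
    case False
    have "b \<in> real_sphere" "b0 \<in> real_sphere"
      using bb False by (auto intro!: real adm)
    from boundary_root_balance[OF hol Im nz a0 this(2) a this(1) nonneg, of x] ne aa0
    show ?thesis by (auto simp: root_count_def split: if_splits)
  next
    case True
    have "Im (M z * (root_form a0 z * root_form None z) * cnj (root_form None z * root_form a z)) \<ge> 0"
      if z: "Im z > 0" for z
    proof (rule continuous_nonneg_at[where z = z and
          g = "\<lambda>z. Im (M z * (root_form a0 z * root_form None z) * cnj (root_form None z * root_form a z))"])
      show "isCont (\<lambda>z. Im (M z * (root_form a0 z * root_form None z) * cnj (root_form None z * root_form a z))) z"
        by (intro continuous_Im continuous_mult continuous_cnj isCont_root_form contM[OF z])
      have "eventually (\<lambda>w. w \<in> upper_half_plane \<and> w \<noteq> the b) (at z)"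
        using z upper_half_plane_topology(1)
        by (intro eventually_conj eventually_at_in_open' eventually_neq_at_within) auto
      then show "eventually (\<lambda>z. Im (M z * (root_form a0 z * root_form None z) * cnj (root_form None z * root_form a z)) \<ge> 0) (at z)"
      proof eventually_elim
        case (elim w)
        then have "root_form b w \<noteq> 0" using root_form_eq_0_iff[OF adm(4)] by auto
        then have pos: "(norm (root_form b w))\<^sup>2 > 0" by simp
        have "M w * (root_form a0 w * root_form b w) * cnj (root_form b0 w * root_form a w) =
            (root_form b w * cnj (root_form b w)) *
            (M w * (root_form a0 w * root_form None w) * cnj (root_form None w * root_form a w))"
          using True by simp
        also have "\<dots> = of_real ((norm (root_form b w))\<^sup>2) *
            (M w * (root_form a0 w * root_form None w) * cnj (root_form None w * root_form a w))"
          by (simp only: complex_norm_square)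
        finally have eq: "M w * (root_form a0 w * root_form b w) * cnj (root_form b0 w * root_form a w) =
            of_real ((norm (root_form b w))\<^sup>2) *
            (M w * (root_form a0 w * root_form None w) * cnj (root_form None w * root_form a w))" .
        have "Im (of_real ((norm (root_form b w))\<^sup>2) *
            (M w * (root_form a0 w * root_form None w) * cnj (root_form None w * root_form a w))) \<ge> 0"
          using nonneg[of w] elim unfolding eq by (simp only: mem_Collect_eq)
        moreover have "Im (of_real r * y) = r * Im y" for r y by simp
        ultimately have "(norm (root_form b w))\<^sup>2 *
            Im (M w * (root_form a0 w * root_form None w) * cnj (root_form None w * root_form a w)) \<ge> 0"
          by (simp only:)
        then show ?case using pos by (metis linorder_not_le zero_le_mult_iff)
      qed
    qed
    \<comment> \<open>The common pole parameter has been cancelled, leaving \<open>None\<close> in both places.\<close>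
    from boundary_root_balance[OF hol Im nz a0 _ a _ this, of x]
    show ?thesis by (simp add: real_sphere_def root_count_def)
  qed
  show False
    using eqs a a0 aa0 by (force simp: root_count_def real_sphere_def Reals_def split: if_splits)
qed

section \<open>The extended line and the Riemann sphere in coordinates\<close>

lemma continuous_map_Alexandroff_compactification:
  fixes g :: "'a::euclidean_space \<Rightarrow> 'b::topological_space"
  assumes g: "continuous_on UNIV g" and l: "(g \<longlongrightarrow> l) at_infinity"
  shows "continuous_map (Alexandroff_compactification euclidean) euclidean (case_option l g)"
  unfolding continuous_map_def
proof (intro conjI strip)
  fix V :: "'b set" assume "openin euclidean V"
  then have V: "open V" by simp
  have gV: "open (g -` V)" using V g by (rule open_vimage)
  show "openin (Alexandroff_compactification euclidean)
    {x \<in> topspace (Alexandroff_compactification euclidean). case_option l g x \<in> V}"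
  proof (cases "l \<in> V")
    case True
    then have "eventually (\<lambda>x. g x \<in> V) at_infinity" using l V by (rule topological_tendstoD[rotated 2])
    then obtain B where B: "\<And>x. norm x \<ge> B \<Longrightarrow> g x \<in> V" by (auto simp: eventually_at_infinity)
    have "norm x \<le> B" if "x \<in> - (g -` V)" for x
      using that B[of x] by (cases "norm x \<ge> B") auto
    then have "bounded (- (g -` V))" unfolding bounded_iff by blast
    then have "compact (- (g -` V))" using gV by (simp add: compact_eq_bounded_closed closed_def)
    moreover have "{x \<in> topspace (Alexandroff_compactification euclidean). case_option l g x \<in> V} =
        insert None (Some ` (topspace euclidean - - (g -` V)))"
    proof (rule Set.set_eqI)
      show "x \<in> {x \<in> topspace (Alexandroff_compactification euclidean). case_option l g x \<in> V} \<longleftrightarrow>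
          x \<in> insert None (Some ` (topspace euclidean - - (g -` V)))" for x
        using True by (cases x) auto
    qed
    ultimately show ?thesis
      using gV by (auto simp: openin_Alexandroff_compactification closed_def)
  next
    case False
    then have "{x \<in> topspace (Alexandroff_compactification euclidean). case_option l g x \<in> V} = Some ` (g -` V)"
      by (auto split: option.splits)
    then show ?thesis using gV by simp
  qed
qed simp

lemma tendsto_at_infinity_inverse:
  fixes f g :: "'a::real_normed_field \<Rightarrow> 'b::topological_space"
  assumes "isCont f 0" and "\<And>x. x \<noteq> 0 \<Longrightarrow> g x = f (inverse x)"
  shows "(g \<longlongrightarrow> f 0) at_infinity"
proof -
  have "((\<lambda>x. f (inverse x)) \<longlongrightarrow> f 0) at_infinity"
    by (rule isCont_tendsto_compose[OF assms(1) tendsto_inverse_0])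
  moreover have "eventually (\<lambda>x::'a. x \<noteq> 0) at_infinity"
    unfolding eventually_at_infinity by (intro exI[of _ 1]) auto
  then have "eventually (\<lambda>x. f (inverse x) = g x) at_infinity"
    by eventually_elim (simp add: assms)
  ultimately show ?thesis by (rule Lim_transform_eventually)
qed

text \<open>
  The Cayley transform. It maps \<open>t = tan (\<phi> / 2)\<close> to \<open>cis \<phi>\<close>.
\<close>

definition line_circle :: "real option \<Rightarrow> complex" where
  "line_circle = case_option (-1) (\<lambda>t. (1 + \<i> * of_real t) / (1 - \<i> * of_real t))"

lemma one_minus_i_times_real_neq_0 [simp]: "1 - \<i> * complex_of_real t \<noteq> 0"
  by (simp add: complex_eq_iff)

lemma extended_real_line_compact_Hausdorff:
  "compact_space extended_real_line" "Hausdorff_space extended_real_line" "topspace extended_real_line = UNIV"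
  by (simp_all add: extended_real_line_def Hausdorff_space_Alexandroff_compactification
      Hausdorff_space_euclidean locally_compact_space_euclidean UNIV_option_conv)

lemma riemann_sphere_compact_Hausdorff:
  "compact_space riemann_sphere" "Hausdorff_space riemann_sphere" "topspace riemann_sphere = UNIV"
  by (simp_all add: riemann_sphere_def Hausdorff_space_Alexandroff_compactification
      Hausdorff_space_euclidean locally_compact_space_euclidean UNIV_option_conv)

text \<open>
  A continuous bijection from a compact space to a Hausdorff space.
\<close>

lemma homeomorphic_map_line_circle:
  "homeomorphic_map extended_real_line (top_of_set (sphere 0 1)) line_circle"
proof (rule continuous_imp_homeomorphic_map)
  show "continuous_map extended_real_line (top_of_set (sphere 0 1)) line_circle"
  proof (rule continuous_map_into_subtopology)
    have "((\<lambda>t::real. (1 + \<i> * of_real t) / (1 - \<i> * of_real t)) \<longlongrightarrow>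
        (\<lambda>w::real. (of_real w + \<i>) / (of_real w - \<i>)) 0) at_infinity"
    proof (rule tendsto_at_infinity_inverse)
      show "isCont (\<lambda>w::real. (of_real w + \<i>) / (of_real w - \<i>)) 0"
        by (intro continuous_intros) auto
      fix t :: real assume "t \<noteq> 0"
      moreover have "inverse (complex_of_real t) - \<i> \<noteq> 0" by (simp add: complex_eq_iff)
      ultimately show "(1 + \<i> * of_real t) / (1 - \<i> * of_real t) = (of_real (inverse t) + \<i>) / (of_real (inverse t) - \<i>)"
        by (simp add: field_simps)
    qed
    then have "((\<lambda>t::real. (1 + \<i> * of_real t) / (1 - \<i> * of_real t)) \<longlongrightarrow> -1) at_infinity"
      by simp
    moreover have "continuous_on UNIV (\<lambda>t::real. (1 + \<i> * of_real t) / (1 - \<i> * of_real t))"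
      by (intro continuous_intros) auto
    ultimately show "continuous_map extended_real_line euclidean line_circle"
      unfolding extended_real_line_def line_circle_def
      by (intro continuous_map_Alexandroff_compactification)
    have "norm (1 + \<i> * complex_of_real t) = norm (1 - \<i> * complex_of_real t)" for t
      by (simp add: cmod_def)
    moreover have "norm (1 - \<i> * complex_of_real t) \<noteq> 0" for t by (simp only: norm_eq_zero) simp
    ultimately show "line_circle \<in> topspace extended_real_line \<rightarrow> sphere 0 1"
      by (auto simp: line_circle_def norm_divide split: option.splits)
  qed
  show "inj_on line_circle (topspace extended_real_line)"
  proof (rule inj_onI)
    fix s t :: "real option" assume eq: "line_circle s = line_circle t"
    have neg: "(1 + \<i> * complex_of_real x) / (1 - \<i> * complex_of_real x) \<noteq> -1" for x
    proof
      assume "(1 + \<i> * complex_of_real x) / (1 - \<i> * complex_of_real x) = -1"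
      then have "1 + \<i> * complex_of_real x = -1 * (1 - \<i> * complex_of_real x)"
        by (simp only: nonzero_divide_eq_eq[OF one_minus_i_times_real_neq_0])
      then have "Re (1 + \<i> * complex_of_real x) = Re (-1 * (1 - \<i> * complex_of_real x))"
        by (rule arg_cong)
      then show False by simp
    qed
    have "x = y" if "(1 + \<i> * complex_of_real x) / (1 - \<i> * complex_of_real x) =
        (1 + \<i> * complex_of_real y) / (1 - \<i> * complex_of_real y)" for x y
    proof -
      from that have "(1 + \<i> * complex_of_real x) * (1 - \<i> * complex_of_real y) =
          (1 + \<i> * complex_of_real y) * (1 - \<i> * complex_of_real x)"
        by (simp only: frac_eq_eq[OF one_minus_i_times_real_neq_0 one_minus_i_times_real_neq_0])
      from arg_cong[OF this, of Im] show ?thesis by simp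
    qed
    then show "s = t" using eq neg neg[symmetric]
      by (cases s; cases t) (auto simp: line_circle_def)
  qed
  show "line_circle ` topspace extended_real_line = topspace (top_of_set (sphere 0 1))"
  proof (intro equalityI subsetI)
    fix u assume "u \<in> line_circle ` topspace extended_real_line"
    moreover have "norm (1 + \<i> * complex_of_real t) = norm (1 - \<i> * complex_of_real t)" for t
      by (simp add: cmod_def)
    moreover have "norm (1 - \<i> * complex_of_real t) \<noteq> 0" for t by (simp only: norm_eq_zero) simp
    ultimately show "u \<in> topspace (top_of_set (sphere 0 1))"
      by (auto simp: line_circle_def norm_divide split: option.splits)
  next
    fix u :: complex assume "u \<in> topspace (top_of_set (sphere 0 1))"
    then have u: "(Re u)\<^sup>2 + (Im u)\<^sup>2 = 1" by (simp add: cmod_power2[symmetric])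
    show "u \<in> line_circle ` topspace extended_real_line"
    proof (cases "u = -1")
      case True
      then show ?thesis
        by (intro image_eqI[of _ _ None]) (simp_all add: line_circle_def extended_real_line_compact_Hausdorff)
    next
      case False
      define t where "t = Im u / (1 + Re u)"
      have "1 + Re u \<noteq> 0"
      proof
        assume "1 + Re u = 0"
        then have "Re u = -1" by simp
        with u have "Im u = 0" by simp
        with \<open>Re u = -1\<close> False show False by (simp add: complex_eq_iff)
      qed
      then have t: "t * (1 + Re u) = Im u" by (simp add: t_def)
      have "t * Im u * (1 + Re u) = (1 - Re u) * (1 + Re u)"
      proof -
        have "t * Im u * (1 + Re u) = Im u * (t * (1 + Re u))" by simp
        also have "\<dots> = (Im u)\<^sup>2" unfolding t by (simp add: power2_eq_square)
        also have "\<dots> = (1 - Re u) * (1 + Re u)" using u by (simp add: algebra_simps power2_eq_square)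
        finally show ?thesis .
      qed
      then have t2: "t * Im u = 1 - Re u" using \<open>1 + Re u \<noteq> 0\<close> by simp
      have "u * (1 - \<i> * of_real t) = 1 + \<i> * of_real t"
        using t t2 by (simp add: complex_eq_iff algebra_simps)
      then have "u = (1 + \<i> * of_real t) / (1 - \<i> * of_real t)"
        by (simp add: nonzero_eq_divide_eq)
      then show ?thesis
        by (intro image_eqI[of _ _ "Some t"]) (simp_all add: line_circle_def extended_real_line_compact_Hausdorff)
    qed
  qed
qed (simp_all add: extended_real_line_compact_Hausdorff Hausdorff_space_subtopology)

text \<open>
  Two of the three stereographic coordinates of a point of the sphere. The missing one is determined
  up to sign by them, and its sign is fixed on the closed upper half-plane.
\<close>

definition sphere_coord :: "complex option \<Rightarrow> complex" where
  "sphere_coord = case_option \<i>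
     (\<lambda>a. Complex (2 * Re a / (1 + (norm a)\<^sup>2)) ((norm a)\<^sup>2 / (1 + (norm a)\<^sup>2)))"

text \<open>
  The root form is an affine function of the coordinates; this is what makes it continuous in its
  parameter, infinity included.
\<close>

lemma root_form_sphere_coord:
  "root_form a z = of_real (1 - Im (sphere_coord a)) * z\<^sup>2 - of_real (Re (sphere_coord a)) * z + of_real (Im (sphere_coord a))"
proof (cases a)
  case (Some w)
  define N where "N = 1 + (norm w)\<^sup>2"
  have N: "N \<noteq> 0" by (simp add: N_def)
  have "(z - w) * (z - cnj w) = z\<^sup>2 - (w + cnj w) * z + w * cnj w"
    by (simp add: algebra_simps power2_eq_square)
  also have "w * cnj w = of_real ((norm w)\<^sup>2)" by (simp only: complex_norm_square)
  also have "(norm w)\<^sup>2 = N - 1" by (simp add: N_def)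
  also have "w + cnj w = of_real (2 * Re w)" by (simp add: complex_add_cnj)
  finally have "root_form a z = (z\<^sup>2 - of_real (2 * Re w) * z + of_real (N - 1)) / of_real N"
    using Some by (simp add: N_def)
  also have "\<dots> = of_real (1 - (N - 1) / N) * z\<^sup>2 - of_real (2 * Re w / N) * z + of_real ((N - 1) / N)"
    using N by (simp add: field_simps)
  finally show ?thesis using Some by (simp add: sphere_coord_def N_def)
qed (simp add: sphere_coord_def)

text \<open>
  Near infinity the coordinates are rewritten in terms of \<open>w = inverse a\<close>.
\<close>

lemma continuous_map_sphere_coord: "continuous_map riemann_sphere euclidean sphere_coord"
  unfolding riemann_sphere_def sphere_coord_def
proof (rule continuous_map_Alexandroff_compactification)
  show "continuous_on UNIV (\<lambda>a. Complex (2 * Re a / (1 + (norm a)\<^sup>2)) ((norm a)\<^sup>2 / (1 + (norm a)\<^sup>2)))"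
    by (intro continuous_intros) auto
  have "((\<lambda>a. Complex (2 * Re a / (1 + (norm a)\<^sup>2)) ((norm a)\<^sup>2 / (1 + (norm a)\<^sup>2))) \<longlongrightarrow>
     (\<lambda>w. Complex (2 * Re w / (1 + (norm w)\<^sup>2)) (1 / (1 + (norm w)\<^sup>2))) 0) at_infinity"
  proof (rule tendsto_at_infinity_inverse)
    have "continuous_on UNIV (\<lambda>w. Complex (2 * Re w / (1 + (norm w)\<^sup>2)) (1 / (1 + (norm w)\<^sup>2)))"
      by (intro continuous_intros) auto
    then show "isCont (\<lambda>w. Complex (2 * Re w / (1 + (norm w)\<^sup>2)) (1 / (1 + (norm w)\<^sup>2))) 0"
      by (simp add: continuous_on_eq_continuous_at)
    fix a :: complex assume a: "a \<noteq> 0"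
    have "1 + (norm (inverse a))\<^sup>2 = (1 + (norm a)\<^sup>2) / (norm a)\<^sup>2"
    proof -
      have "(norm (inverse a))\<^sup>2 = 1 / (norm a)\<^sup>2"
        by (simp add: norm_inverse power_inverse inverse_eq_divide[symmetric])
      moreover have "(norm a)\<^sup>2 \<noteq> 0" using a by simp
      moreover have "1 + 1 / n = (1 + n) / n" if "n \<noteq> 0" for n :: real
        using that by (simp add: field_simps)
      ultimately show ?thesis by simp
    qed
    moreover have "Re (inverse a) = Re a / (norm a)\<^sup>2" by (simp add: cmod_power2)
    ultimately have "Complex (2 * Re (inverse a) / (1 + (norm (inverse a))\<^sup>2)) (1 / (1 + (norm (inverse a))\<^sup>2)) =
      Complex (2 * (Re a / (norm a)\<^sup>2) / ((1 + (norm a)\<^sup>2) / (norm a)\<^sup>2)) (1 / ((1 + (norm a)\<^sup>2) / (norm a)\<^sup>2))"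
      by (simp only:)
    then show "Complex (2 * Re a / (1 + (norm a)\<^sup>2)) ((norm a)\<^sup>2 / (1 + (norm a)\<^sup>2)) =
      Complex (2 * Re (inverse a) / (1 + (norm (inverse a))\<^sup>2)) (1 / (1 + (norm (inverse a))\<^sup>2))"
      using a by (simp only: norm_eq_zero power_eq_0_iff) simp
  qed
  moreover have "Complex 0 1 = \<i>" by (simp add: complex_eq_iff)
  ultimately show "((\<lambda>a. Complex (2 * Re a / (1 + (norm a)\<^sup>2)) ((norm a)\<^sup>2 / (1 + (norm a)\<^sup>2))) \<longlongrightarrow> \<i>) at_infinity"
    by simp
qed

lemma inj_on_sphere_coord: "inj_on sphere_coord closed_upper_sphere"
proof (rule inj_onI)
  fix a b assume ab: "a \<in> closed_upper_sphere" "b \<in> closed_upper_sphere" and eq: "sphere_coord a = sphere_coord b"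
  have pos: "1 + (norm w)\<^sup>2 > 0" for w :: complex by (simp add: add_pos_nonneg)
  have none: "sphere_coord (Some w) \<noteq> sphere_coord None" for w
    using pos[of w] by (auto simp: sphere_coord_def complex_eq_iff)
  have "v = w" if vw: "Im v \<ge> 0" "Im w \<ge> 0" and e: "sphere_coord (Some v) = sphere_coord (Some w)" for v w
  proof -
    from e have "(norm v)\<^sup>2 / (1 + (norm v)\<^sup>2) = (norm w)\<^sup>2 / (1 + (norm w)\<^sup>2)"
      by (simp add: sphere_coord_def)
    then have n: "(norm v)\<^sup>2 = (norm w)\<^sup>2"
      by (simp add: frac_eq_eq algebra_simps)
    with e have R: "Re v = Re w" by (simp add: sphere_coord_def)
    with n have "(Im v)\<^sup>2 = (Im w)\<^sup>2" by (simp add: cmod_power2)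
    then have "Im v = Im w" using vw by (simp add: power2_eq_iff_nonneg)
    with R show "v = w" by (simp add: complex_eq_iff)
  qed
  then show "a = b"
    using ab eq none none[symmetric] by (cases a; cases b) (auto simp: closed_upper_sphere_def)
qed

lemma closedin_closed_upper_sphere: "closedin riemann_sphere closed_upper_sphere"
proof -
  have "UNIV - closed_upper_sphere = Some ` {w. Im w < 0}"
    by (auto simp: closed_upper_sphere_def image_iff) (metis not_Some_eq not_le)
  then have "openin riemann_sphere (UNIV - closed_upper_sphere)"
    by (simp add: riemann_sphere_def open_halfspace_Im_lt)
  then show ?thesis
    by (simp add: closedin_def riemann_sphere_compact_Hausdorff)
qed

section \<open>Functions of the class have values in the lower half-plane\<close>

text \<open>
  At a pole \<open>f = g / (z - z0)\<^sup>k\<close>, which up to a positive factor is \<open>g * cnj ((z - z0)\<^sup>k)\<close>.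
\<close>

lemma Im_nonneg_imp_not_pole:
  assumes iso: "isolated_singularity_at f z0"
    and nonneg: "eventually (\<lambda>z. Im (f z) \<ge> 0) (at z0)"
  shows "\<not> is_pole f z0"
proof
  assume pole: "is_pole f z0"
  obtain r where r: "r > 0" "f analytic_on ball z0 r - {z0}"
    using iso by (auto simp: isolated_singularity_at_def)
  define k where "k = nat (- zorder f z0)"
  define g where "g = zor_poly f z0"
  have "zorder f z0 < 0 \<and> g z0 \<noteq> 0 \<and> (\<exists>r'. r' > 0 \<and> cball z0 r' \<subseteq> ball z0 r \<and> g holomorphic_on cball z0 r'
    \<and> (\<forall>w\<in>cball z0 r' - {z0}. f w = g w / (w - z0) ^ k \<and> g w \<noteq> 0))"
    unfolding k_def g_def
    by (rule zorder_exist_pole) (use r pole in \<open>auto intro: analytic_imp_holomorphic\<close>)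
  then obtain r' where k: "zorder f z0 < 0" and g0: "g z0 \<noteq> 0"
    and r': "r' > 0" "g holomorphic_on cball z0 r'" "\<And>w. w \<in> cball z0 r' - {z0} \<Longrightarrow> f w = g w / (w - z0) ^ k"
    by blast
  have "0 = k"
  proof (rule orders_eq_interior)
    have "g holomorphic_on ball z0 r'" using r'(2) by (rule holomorphic_on_subset) auto
    then show "isCont g z0" using r'(1) by (intro holomorphic_on_open_imp_isCont[of g "ball z0 r'"]) auto
    have "eventually (\<lambda>w. w \<in> ball z0 r' - {z0}) (at z0)"
      using r'(1) by (intro eventually_at_in_open) auto
    with nonneg show "eventually (\<lambda>w. Im (g w * (w - z0) ^ 0 * cnj ((w - z0) ^ k)) \<ge> 0) (at z0)"
    proof eventually_elim
      case (elim w)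
      then have "g w = f w * (w - z0) ^ k" using r'(3)[of w] by auto
      then have "g w * (w - z0) ^ 0 * cnj ((w - z0) ^ k) = of_real ((norm ((w - z0) ^ k))\<^sup>2) * f w"
        by (simp only: complex_norm_square power_0 mult_1_right mult_1 mult_ac)
      moreover have "Im (of_real x * y) = x * Im y" for x y by simp
      ultimately show ?case using elim(1) by (simp only: zero_le_power2 mult_nonneg_nonneg)
    qed
  qed (rule g0)
  then show False using k by (simp add: k_def)
qed

text \<open>
  Otherwise the singularities of \<open>Q\<close> in the half-plane would be removable and, by Pick's theorem, no
  matrix of its kernel would have a negative eigenvalue.
\<close>

lemma class_N1_not_Im_nonneg:
  assumes Q: "class_N1 Q"
  shows "\<not> (\<forall>\<^sub>\<approx>z\<in>upper_half_plane. Im (Q z) \<ge> 0)"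
proof
  assume nonneg: "\<forall>\<^sub>\<approx>z\<in>upper_half_plane. Im (Q z) \<ge> 0"
  have mero: "Q meromorphic_on upper_half_plane" using Q by (simp add: class_N1_def)
  define M where "M = remove_sings Q"
  have ev: "eventually (\<lambda>w. Im (Q w) \<ge> 0) (at z)" if "Im z > 0" for z
    using nonneg that by (auto simp: eventually_cosparse_open_eq upper_half_plane_topology)
  have iso: "isolated_singularity_at Q z" if "Im z > 0" for z
    using meromorphic_on_subset[OF mero, of "{z}"] that
    by (intro meromorphic_on_isolated_singularity) auto
  have "M analytic_on {z}" if z: "Im z > 0" for z
  proof -
    have "M nicely_meromorphic_on upper_half_plane"
      unfolding M_def by (rule remove_sings_nicely_meromorphic[OF mero])
    moreover have "\<not> is_pole M z"
      using Im_nonneg_imp_not_pole[OF iso[OF z] ev[OF z]] iso[OF z] by (simp add: M_def is_pole_remove_sings_iff)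
    ultimately show ?thesis using z nicely_meromorphic_on_imp_analytic_at by blast
  qed
  then have hol: "M holomorphic_on upper_half_plane"
    using analytic_imp_holomorphic analytic_on_analytic_at by blast
  have ImM: "Im (M z) \<ge> 0" if z: "Im z > 0" for z
  proof (rule continuous_nonneg_at[where g = "\<lambda>z. Im (M z)" and z = z])
    show "isCont (\<lambda>z. Im (M z)) z"
      using z by (intro continuous_Im holomorphic_on_open_imp_isCont[OF hol] upper_half_plane_topology) auto
    have "eventually (\<lambda>w. M w = Q w) (at z)"
      unfolding M_def by (rule eventually_remove_sings_eq_at[OF iso[OF z]])
    with ev[OF z] show "eventually (\<lambda>w. Im (M w) \<ge> 0) (at z)"
      by eventually_elim simp
  qed
  obtain zs where zs: "set zs \<subseteq> {z \<in> upper_half_plane. Q analytic_on {z}}"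
    and one: "num_neg_eigenvalues (nevanlinna_matrix Q zs) = 1"
    using Q by (auto simp: class_N1_def)
  have nth: "Im (zs ! i) > 0" "M (zs ! i) = Q (zs ! i)" if "i < length zs" for i
  proof -
    have "zs ! i \<in> {z \<in> upper_half_plane. Q analytic_on {z}}" using zs that nth_mem by blast
    then show "Im (zs ! i) > 0" "M (zs ! i) = Q (zs ! i)" by (simp_all add: M_def)
  qed
  have "num_neg_eigenvalues (nevanlinna_matrix Q zs) = 0"
  proof (rule num_neg_eigenvalues_eq_0)
    show "nevanlinna_matrix Q zs \<in> carrier_mat (length zs) (length zs)"
      by (simp add: nevanlinna_matrix_def)
    fix v :: "nat \<Rightarrow> complex"
    have "Re (\<Sum>i<length zs. \<Sum>j<length zs. v i * cnj (v j) * nevanlinna_kernel M (zs ! i) (zs ! j)) \<ge> 0"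
      by (rule Pick_kernel_nonneg[OF hol ImM]) (use nth in auto)
    moreover have "(\<Sum>i<length zs. \<Sum>j<length zs. v i * cnj (v j) * nevanlinna_kernel M (zs ! i) (zs ! j)) =
       (\<Sum>i<length zs. \<Sum>j<length zs. v i * cnj (v j) * nevanlinna_matrix Q zs $$ (i, j))"
      by (intro sum.cong refl) (simp add: nevanlinna_matrix_def nevanlinna_kernel_def nth)
    ultimately show "Re (\<Sum>i<length zs. \<Sum>j<length zs. v i * cnj (v j) * nevanlinna_matrix Q zs $$ (i, j)) \<ge> 0"
      by simp
  qed
  with one show False by simp
qed

section \<open>Transforms tend to zero at their zero parameter\<close>

text \<open>
  A Schwarz--Pick bound: the kernel at the two points \<open>x + \<i> y\<close> and \<open>x + \<i>\<close> is nonnegative.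
\<close>

lemma vertical_growth:
  assumes hol: "M holomorphic_on upper_half_plane" and Im: "\<And>z. Im z > 0 \<Longrightarrow> Im (M z) \<ge> 0"
    and x: "x \<in> \<real>" and y: "y > 0"
  shows "y * norm (M (x + \<i> * of_real y)) \<le> 2 * norm (M (x + \<i>)) * (1 + y)\<^sup>2"
proof -
  define z where "z = x + \<i> * of_real y"
  define w where "w = x + \<i>"
  define K where "K = nevanlinna_kernel M"
  \<comment> \<open>The weight of the first point; it balances the diagonal term \<open>s\<^sup>2 * Im (M z) / y\<close>
    against the mixed term, avoiding a division by \<open>M w\<close>.\<close>
  define s where "s = y / (1 + y)"
  have Imx: "Im x = 0" using x by (simp add: complex_is_Real_iff)
  have zw: "Im z = y" "Im w = 1" using Imx by (simp_all add: z_def w_def)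
  have diag: "K v v = of_real (Im (M v) / Im v)" if "Im v \<noteq> 0" for v
    using that by (simp add: K_def nevanlinna_kernel_def complex_diff_cnj)
  have herm: "K w z = cnj (K z w)"
    unfolding K_def nevanlinna_kernel_def
    by (simp add: divide_simps) (simp add: algebra_simps)
  define \<sigma> where "\<sigma> = sgn (K z w)"
  define c where "c = (\<lambda>i::nat. if i = 0 then of_real s else - \<sigma>)"
  define p where "p = (\<lambda>i::nat. if i = 0 then z else w)"
  define A where "A = Im (M z) / y"
  define B where "B = Im (M w)"
  define k where "k = norm (K z w)"
  have "Re (\<Sum>i\<in>{0,1::nat}. \<Sum>j\<in>{0,1::nat}. c i * cnj (c j) * K (p i) (p j)) \<ge> 0"
    unfolding K_def by (rule Pick_kernel_nonneg[OF hol Im]) (use y zw in \<open>auto simp: p_def\<close>)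
  also have "(\<Sum>i\<in>{0,1::nat}. \<Sum>j\<in>{0,1::nat}. c i * cnj (c j) * K (p i) (p j)) =
      of_real s * of_real s * K z z - of_real s * (cnj \<sigma> * K z w)
      - of_real s * (\<sigma> * cnj (K z w)) + \<sigma> * cnj \<sigma> * K w w"
    by (simp add: c_def p_def herm)
  also have "\<sigma> * cnj (K z w) = of_real k"
    unfolding \<sigma>_def k_def by (auto simp: sgn_eq complex_norm_square[symmetric] power2_eq_square)
  also have "cnj \<sigma> * K z w = of_real k"
    using \<open>\<sigma> * cnj (K z w) = of_real k\<close> by (metis complex_cnj_cnj complex_cnj_complex_of_real complex_cnj_mult)
  also have "\<sigma> * cnj \<sigma> = of_real ((norm \<sigma>)\<^sup>2)" by (simp only: complex_norm_square)
  also have "K z z = of_real A" using diag[of z] y zw by (simp add: A_def)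
  also have "K w w = of_real B" using diag[of w] zw by (simp add: B_def)
  finally have main: "s * s * A - 2 * (s * k) + (norm \<sigma>)\<^sup>2 * B \<ge> 0" by (simp add: mult.commute[of k s])
  have k: "(norm (M z) - norm (M w)) / (1 + y) \<le> k"
  proof -
    have "z - cnj w = \<i> * of_real (1 + y)"
      using Imx by (simp add: z_def w_def complex_eq_iff)
    then have "norm (z - cnj w) = 1 + y" using y by (simp only: norm_mult norm_of_real) simp
    moreover have "norm (M z) - norm (M w) \<le> norm (M z - cnj (M w))"
      using norm_triangle_ineq2[of "M z" "cnj (M w)"] by simp
    ultimately show ?thesis
      using y by (simp add: k_def K_def nevanlinna_kernel_def norm_divide divide_right_mono)
  qed
  have s: "s \<ge> 0" "s * (1 + y) = y" using y by (simp_all add: s_def)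
  have A: "y * A \<le> norm (M z)" using abs_Im_le_cmod[of "M z"] y by (simp add: A_def)
  have B: "0 \<le> B" "B \<le> norm (M w)" using abs_Im_le_cmod[of "M w"] Im[of w] zw by (simp_all add: B_def)
  have "norm \<sigma> \<le> 1" by (simp add: \<sigma>_def norm_sgn)
  then have "(norm \<sigma>)\<^sup>2 \<le> 1" by (simp add: power_le_one)
  then have sB: "(norm \<sigma>)\<^sup>2 * B \<le> norm (M w)"
    using B mult_right_mono[of "(norm \<sigma>)\<^sup>2" 1 B] by linarith
  have y2: "2 * y \<le> (1 + y)\<^sup>2" by (simp add: power2_eq_square algebra_simps)
  have "norm (M z) - norm (M w) \<le> k * (1 + y)" using k y by (simp add: divide_le_eq)
  then have "y * (norm (M z) - norm (M w)) \<le> y * (k * (1 + y))" using y by (intro mult_left_mono) auto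
  also have "\<dots> = s * k * (1 + y)\<^sup>2" using s(2) by (simp add: power2_eq_square)
  finally have 1: "y * (norm (M z) - norm (M w)) \<le> s * k * (1 + y)\<^sup>2" .
  have "0 \<le> (s * s * A - 2 * (s * k) + (norm \<sigma>)\<^sup>2 * B) * (1 + y)\<^sup>2"
    using main by simp
  also have "\<dots> = (s * (1 + y)) * (s * (1 + y)) * A - 2 * (s * k * (1 + y)\<^sup>2) + (norm \<sigma>)\<^sup>2 * B * (1 + y)\<^sup>2"
    by (simp add: algebra_simps power2_eq_square)
  also have "\<dots> = y * (y * A) - 2 * (s * k * (1 + y)\<^sup>2) + (norm \<sigma>)\<^sup>2 * B * (1 + y)\<^sup>2"
    unfolding s(2) by simp
  finally have 2: "2 * (s * k * (1 + y)\<^sup>2) \<le> y * (y * A) + (norm \<sigma>)\<^sup>2 * B * (1 + y)\<^sup>2" by simp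
  have 3: "y * (y * A) \<le> y * norm (M z)" using A y by (intro mult_left_mono) auto
  have 4: "(norm \<sigma>)\<^sup>2 * B * (1 + y)\<^sup>2 \<le> norm (M w) * (1 + y)\<^sup>2" using sB by (intro mult_right_mono) auto
  have 5: "2 * y * norm (M w) \<le> (1 + y)\<^sup>2 * norm (M w)" using y2 by (intro mult_right_mono) auto
  have "y * norm (M z) \<le> 2 * norm (M w) * (1 + y)\<^sup>2"
    using 1 2 3 4 5 by (simp add: algebra_simps)
  then show ?thesis by (simp add: z_def w_def)
qed

text \<open>
  A path in the open upper half-plane that reaches the parameter vertically as \<open>y\<close> tends to \<open>0\<close>.
\<close>

primrec approach :: "complex option \<Rightarrow> real \<Rightarrow> complex" where
  "approach None = (\<lambda>y. \<i> / of_real y)"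
| "approach (Some a) = (\<lambda>y. a + \<i> * of_real y)"

lemma Im_approach_pos:
  assumes "a \<in> closed_upper_sphere" "y > 0"
  shows "Im (approach a y) > 0"
  using assms by (cases a) (auto simp: closed_upper_sphere_def Im_divide_of_real add_nonneg_pos)

lemma approach_eventually_neq:
  "eventually (\<lambda>y. approach a y \<noteq> w) (at_right 0)"
proof (cases a)
  case None
  have "eventually (\<lambda>y::real. y \<noteq> Re (\<i> / w) \<and> 0 < y) (at_right 0)"
    by (intro eventually_conj eventually_neq_at_within eventually_at_right_less)
  then show ?thesis
  proof eventually_elim
    case (elim y)
    have "Re (\<i> / (\<i> / complex_of_real y)) = y" using elim by simp
    then show ?case using None elim by auto
  qed
next
  case (Some v)
  have "eventually (\<lambda>y::real. y \<noteq> Re ((w - v) / \<i>)) (at_right 0)"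
    by (rule eventually_neq_at_within)
  then show ?thesis
    by eventually_elim (use Some in auto)
qed

lemma square_times_tendsto_0:
  fixes f :: "real \<Rightarrow> complex"
  assumes "\<And>y. y > 0 \<Longrightarrow> y * norm (f y) \<le> C * (1 + y)\<^sup>2"
  shows "((\<lambda>y. (of_real y)\<^sup>2 * f y) \<longlongrightarrow> 0) (at_right 0)"
proof (rule Lim_null_comparison)
  have "((\<lambda>y::real. y * (C * (1 + y)\<^sup>2)) \<longlongrightarrow> 0 * (C * (1 + 0)\<^sup>2)) (at_right 0)"
    by (intro tendsto_intros)
  then show "((\<lambda>y::real. y * (C * (1 + y)\<^sup>2)) \<longlongrightarrow> 0) (at_right 0)" by simp
  show "eventually (\<lambda>y. norm ((of_real y)\<^sup>2 * f y) \<le> y * (C * (1 + y)\<^sup>2)) (at_right 0)"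
    using eventually_at_right_less[of 0]
  proof eventually_elim
    case (elim y)
    have "norm ((of_real y)\<^sup>2 * f y) = y * (y * norm (f y))"
      using elim by (simp add: norm_mult norm_power power2_eq_square)
    also have "\<dots> \<le> y * (C * (1 + y)\<^sup>2)" using assms[of y] elim by (intro mult_left_mono) auto
    finally show ?case .
  qed
qed

text \<open>
  At a real zero parameter the root form contributes a factor \<open>y\<^sup>2\<close>, whereas \<open>M\<close> grows at most like
  \<open>1 / y\<close>; infinity behaves in the same way. At a parameter in the open half-plane \<open>M\<close> is
  continuous and the root form vanishes.
\<close>

lemma tendsto_0_at_zero_parameter:
  assumes hol: "M holomorphic_on upper_half_plane" and Im: "\<And>z. Im z > 0 \<Longrightarrow> Im (M z) \<ge> 0"
    and a: "a \<in> closed_upper_sphere" and b: "b \<in> closed_upper_sphere" and ne: "a \<noteq> b"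
  shows "((\<lambda>y. root_form a (approach a y) / root_form b (approach a y) * M (approach a y)) \<longlongrightarrow> 0) (at_right 0)"
proof (cases a)
  case None
  then obtain v where v: "b = Some v" using ne by (cases b) auto
  define N where "N = complex_of_real (1 + (norm v)\<^sup>2)"
  have "((\<lambda>y. (of_real y)\<^sup>2 * M (\<i> / of_real y)) \<longlongrightarrow> 0) (at_right 0)"
  proof (rule square_times_tendsto_0)
    fix y :: real assume y: "y > 0"
    have "(1 / y) * norm (M (0 + \<i> * of_real (1 / y))) \<le> 2 * norm (M (0 + \<i>)) * (1 + 1 / y)\<^sup>2"
      by (rule vertical_growth[OF hol Im]) (use y in auto)
    then have "y\<^sup>2 * ((1 / y) * norm (M (\<i> / of_real y))) \<le> y\<^sup>2 * (2 * norm (M \<i>) * (1 + 1 / y)\<^sup>2)"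
      by (intro mult_left_mono) (simp_all add: divide_inverse)
    also have "y\<^sup>2 * ((1 / y) * norm (M (\<i> / of_real y))) = y * norm (M (\<i> / of_real y))"
      using y by (simp add: power2_eq_square)
    also have "y\<^sup>2 * (2 * norm (M \<i>) * (1 + 1 / y)\<^sup>2) = 2 * norm (M \<i>) * (1 + y)\<^sup>2"
      using y by (simp add: field_simps power2_eq_square)
    finally show "y * norm (M (\<i> / of_real y)) \<le> 2 * norm (M \<i>) * (1 + y)\<^sup>2" .
  qed
  then have "((\<lambda>y. N / ((\<i> - v * of_real y) * (\<i> - cnj v * of_real y)) * ((of_real y)\<^sup>2 * M (\<i> / of_real y)))
      \<longlongrightarrow> N / ((\<i> - v * of_real 0) * (\<i> - cnj v * of_real 0)) * 0) (at_right 0)"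
    by (intro tendsto_intros) auto
  moreover have "eventually (\<lambda>y. N / ((\<i> - v * of_real y) * (\<i> - cnj v * of_real y)) * ((of_real y)\<^sup>2 * M (\<i> / of_real y)) =
     root_form a (approach a y) / root_form b (approach a y) * M (approach a y)) (at_right 0)"
    using eventually_at_right_less[of 0]
  proof eventually_elim
    case (elim y)
    have "\<i> / of_real y - u = (\<i> - u * of_real y) / of_real y" for u
      using elim by (simp add: field_simps)
    then show ?case using None v by (simp add: N_def power2_eq_square)
  qed
  ultimately show ?thesis by (simp add: Lim_transform_eventually)
next
  case (Some w)
  have lim: "((\<lambda>y. w + \<i> * of_real y) \<longlongrightarrow> w) (at_right 0)"
  proof -
    have "((\<lambda>y. w + \<i> * of_real y) \<longlongrightarrow> w + \<i> * of_real 0) (at_right 0)" by (intro tendsto_intros)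
    then show ?thesis by simp
  qed
  have w: "Im w \<ge> 0" using a Some by (auto simp: closed_upper_sphere_def)
  have bw: "root_form b w \<noteq> 0"
  proof (cases b)
    case (Some v)
    then have "Im v \<ge> 0" "v \<noteq> w" using b ne \<open>a = Some w\<close> by (auto simp: closed_upper_sphere_def)
    then have "w \<noteq> cnj v" using w by (auto simp: complex_eq_iff)
    then show ?thesis using Some \<open>v \<noteq> w\<close> by simp
  qed simp
  have limb: "((\<lambda>y. root_form b (w + \<i> * of_real y)) \<longlongrightarrow> root_form b w) (at_right 0)"
    by (rule isCont_tendsto_compose[OF isCont_root_form lim])
  show ?thesis
  proof (cases "Im w > 0")
    case True
    have "((\<lambda>y. root_form a (w + \<i> * of_real y)) \<longlongrightarrow> root_form a w) (at_right 0)"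
      by (rule isCont_tendsto_compose[OF isCont_root_form lim])
    moreover have "isCont M w"
      using True by (intro holomorphic_on_open_imp_isCont[OF hol] upper_half_plane_topology) auto
    then have "((\<lambda>y. M (w + \<i> * of_real y)) \<longlongrightarrow> M w) (at_right 0)"
      by (rule isCont_tendsto_compose[OF _ lim])
    ultimately have "((\<lambda>y. root_form a (w + \<i> * of_real y) / root_form b (w + \<i> * of_real y) * M (w + \<i> * of_real y))
         \<longlongrightarrow> root_form a w / root_form b w * M w) (at_right 0)"
      by (intro tendsto_intros limb bw)
    then show ?thesis using Some by simp
  next
    case False
    then have real: "w \<in> \<real>" using w by (simp add: complex_is_Real_iff)
    then have cw: "cnj w = w" by (simp add: Reals_cnj_iff)
    have "((\<lambda>y. (of_real y)\<^sup>2 * M (w + \<i> * of_real y)) \<longlongrightarrow> 0) (at_right 0)"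
      by (rule square_times_tendsto_0) (rule vertical_growth[OF hol Im real])
    then have "((\<lambda>y. - 1 / of_real (1 + (norm w)\<^sup>2) / root_form b (w + \<i> * of_real y) * ((of_real y)\<^sup>2 * M (w + \<i> * of_real y)))
         \<longlongrightarrow> - 1 / of_real (1 + (norm w)\<^sup>2) / root_form b w * 0) (at_right 0)"
      by (intro tendsto_intros limb bw)
    moreover have "root_form a (w + \<i> * of_real y) = - 1 / of_real (1 + (norm w)\<^sup>2) * (of_real y)\<^sup>2" for y :: real
      using Some cw by (simp add: power2_eq_square algebra_simps)
    ultimately show ?thesis using Some by (simp add: mult_ac)
  qed
qed

section \<open>Factorizations of the transforms\<close>

text \<open>
  The transform \<open>Q\<^sub>\<tau>\<close> at \<open>q = Q z\<close>, multiplied by a nonnegative number so as to clear the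
  denominator. For \<open>u = cis \<phi>\<close> and \<open>\<tau> = tan (\<phi> / 2)\<close> it is
  \<open>(cos (\<phi>/2) * q - sin (\<phi>/2)) * (cos (\<phi>/2) + sin (\<phi>/2) * cnj q)\<close>, which is a polynomial in
  the coordinates of \<open>u\<close>; hence it is continuous in \<open>\<tau>\<close>, infinity included.
\<close>

definition circle_form :: "complex \<Rightarrow> complex \<Rightarrow> complex" where
  "circle_form u q = of_real ((1 + Re u) / 2) * q - of_real ((1 - Re u) / 2) * cnj q
     + of_real (Im u / 2 * ((norm q)\<^sup>2 - 1))"

text \<open>
  The sign of the imaginary part is the same for \<open>Q\<close> and all its transforms, since the maps
  \<open>q \<mapsto> (q - \<tau>) / (1 + \<tau> * q)\<close> preserve the upper half-plane.
\<close>

lemma Im_circle_form: "Im (circle_form u q) = Im q"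
proof -
  have "Im (circle_form u q) = (1 + Re u) / 2 * Im q + (1 - Re u) / 2 * Im q"
    by (simp add: circle_form_def)
  also have "\<dots> = Im q" by (simp add: field_simps)
  finally show ?thesis .
qed

text \<open>
  If the denominator of the transform vanishes at \<open>z\<close>, the value \<open>Q z\<close> is real, and then both sides
  are \<open>0\<close> by the convention for division.
\<close>

lemma circle_form_line_circle:
  "\<exists>\<kappa>\<ge>0. circle_form (line_circle \<tau>) (Q z) = of_real \<kappa> * Q_transform Q \<tau> z \<and>
     (Q_transform Q \<tau> z \<noteq> 0 \<longrightarrow> \<kappa> > 0)"
proof (cases \<tau>)
  case None
  have "circle_form (line_circle \<tau>) (Q z) = - cnj (Q z)"
    using None by (simp add: circle_form_def line_circle_def)
  also have "\<dots> = (Q z * cnj (Q z)) * (- 1 / Q z)" by (cases "Q z = 0") simp_all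
  also have "\<dots> = of_real ((norm (Q z))\<^sup>2) * Q_transform Q \<tau> z"
    using None by (simp only: complex_norm_square Q_transform.simps)
  finally show ?thesis using None by (intro exI[of _ "(norm (Q z))\<^sup>2"]) simp
next
  case (Some t)
  define q where "q = Q z"
  define N where "N = 1 + t\<^sup>2"
  have N: "N > 0" by (simp add: N_def add_pos_nonneg)
  have "line_circle \<tau> = Complex ((1 - t\<^sup>2) / N) (2 * t / N)"
  proof -
    have "Complex ((1 - t\<^sup>2) / N) (2 * t / N) * (1 - \<i> * of_real t) = 1 + \<i> * of_real t"
      using N by (simp add: complex_eq_iff field_simps) (simp add: N_def algebra_simps power2_eq_square)
    then show ?thesis using Some by (simp add: line_circle_def nonzero_divide_eq_eq)
  qed
  moreover have "(1 + (1 - t\<^sup>2) / N) / 2 = 1 / N" "(1 - (1 - t\<^sup>2) / N) / 2 = t\<^sup>2 / N" "2 * t / N / 2 = t / N"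
    using N by (simp_all add: field_simps) (simp_all add: N_def algebra_simps)
  ultimately have "circle_form (line_circle \<tau>) q = of_real (1 / N) * q - of_real (t\<^sup>2 / N) * cnj q
     + of_real (t / N * ((norm q)\<^sup>2 - 1))"
    by (simp only: circle_form_def complex.sel)
  also have "\<dots> = of_real (1 / N) * ((q - of_real t) * (1 + of_real t * cnj q))"
  proof -
    have "complex_of_real (t / N * ((norm q)\<^sup>2 - 1)) = of_real (t / N) * (q * cnj q - 1)"
      by (simp only: of_real_mult of_real_diff of_real_1 complex_norm_square)
    then show ?thesis by (simp add: algebra_simps power2_eq_square add_divide_distrib diff_divide_distrib)
  qed
  also have "(q - of_real t) * (1 + of_real t * cnj q) =
      ((1 + of_real t * q) * cnj (1 + of_real t * q)) * ((q - of_real t) / (1 + of_real t * q))"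
  proof (cases "1 + of_real t * q = 0")
    case True
    then have "cnj (1 + of_real t * q) = 0" by (simp only: complex_cnj_zero)
    then have "1 + of_real t * cnj q = 0" by simp
    then show ?thesis using True by simp
  qed simp
  also have "\<dots> = of_real ((norm (1 + of_real t * q))\<^sup>2) * Q_transform Q \<tau> z"
    using Some by (simp only: complex_norm_square Q_transform.simps q_def)
  finally have "circle_form (line_circle \<tau>) (Q z) = of_real (1 / N * (norm (1 + of_real t * q))\<^sup>2) * Q_transform Q \<tau> z"
    by (simp only: q_def of_real_mult mult.assoc)
  moreover have "1 / N * (norm (1 + of_real t * q))\<^sup>2 > 0" if "Q_transform Q \<tau> z \<noteq> 0"
  proof -
    have "1 + of_real t * q \<noteq> 0" using that Some by (auto simp: q_def)
    then have "(norm (1 + of_real t * q))\<^sup>2 > 0" by (metis zero_less_norm_iff zero_less_power)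
    then show ?thesis using N by (simp only: mult_pos_pos zero_less_divide_1_iff)
  qed
  moreover have "1 / N * (norm (1 + of_real t * q))\<^sup>2 \<ge> 0"
    using N by (intro mult_nonneg_nonneg) simp_all
  ultimately show ?thesis by blast
qed

lemma n1_factor_root_form:
  assumes "n1_factor a b R"
  shows "a \<in> closed_upper_sphere \<and> b \<in> closed_upper_sphere \<and>
    (\<exists>\<kappa>>0. \<forall>z. R z = of_real \<kappa> * (root_form a z / root_form b z))"
  using assms
proof cases
  case (both_finite v w)
  have "1 + (norm v)\<^sup>2 > 0" "1 + (norm w)\<^sup>2 > 0" by (simp_all add: add_pos_nonneg)
  then show ?thesis using both_finite
    by (intro conjI exI[of _ "(1 + (norm v)\<^sup>2) / (1 + (norm w)\<^sup>2)"]) (auto simp: closed_upper_sphere_def)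
next
  case (pole_at_infinity v)
  have "1 + (norm v)\<^sup>2 > 0" by (simp add: add_pos_nonneg)
  then show ?thesis using pole_at_infinity
    by (intro conjI exI[of _ "1 + (norm v)\<^sup>2"]) (auto simp: closed_upper_sphere_def)
next
  case (zero_at_infinity w)
  have "1 + (norm w)\<^sup>2 > 0" by (simp add: add_pos_nonneg)
  then show ?thesis using zero_at_infinity
    by (intro conjI exI[of _ "1 / (1 + (norm w)\<^sup>2)"]) (auto simp: closed_upper_sphere_def)
qed

text \<open>
  The positive constant between the rational factor and the quotient of root forms is absorbed into
  \<open>M\<close>.
\<close>

lemma is_GZNT_factorization:
  assumes "is_GZNT Q a"
  obtains b M where "a \<in> closed_upper_sphere" "b \<in> closed_upper_sphere"
    "M holomorphic_on upper_half_plane" "\<And>z. Im z > 0 \<Longrightarrow> Im (M z) \<ge> 0"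
    "\<forall>\<^sub>\<approx>z\<in>upper_half_plane. Q z = root_form a z / root_form b z * M z"
proof -
  obtain b R M where R: "n1_factor a b R" and M: "nevanlinna M" and Q: "\<forall>\<^sub>\<approx>z\<in>upper_half_plane. Q z = R z * M z"
    using assms by (auto simp: is_GZNT_def)
  obtain \<kappa> where \<kappa>: "\<kappa> > 0" "\<And>z. R z = of_real \<kappa> * (root_form a z / root_form b z)"
    and ab: "a \<in> closed_upper_sphere" "b \<in> closed_upper_sphere"
    using n1_factor_root_form[OF R] by blast
  show ?thesis
  proof (rule that[OF ab])
    have "M holomorphic_on upper_half_plane"
      using M by (auto simp: nevanlinna_def intro: holomorphic_on_subset)
    then show "(\<lambda>z. of_real \<kappa> * M z) holomorphic_on upper_half_plane" by (intro holomorphic_intros)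
    show "Im (of_real \<kappa> * M z) \<ge> 0" if "Im z > 0" for z
      using M that \<kappa>(1) by (simp add: nevanlinna_def)
    show "\<forall>\<^sub>\<approx>z\<in>upper_half_plane. Q z = root_form a z / root_form b z * (of_real \<kappa> * M z)"
      using Q by eventually_elim (simp add: \<kappa>(2))
  qed
qed

text \<open>
  Membership in the class excludes the degenerate cases \<open>a = b\<close> and \<open>M = 0\<close>: in both of them the
  imaginary part of \<open>Q\<close> would be nonnegative.
\<close>

lemma N1_GZNT_factorization:
  assumes Q: "class_N1 Q" and a: "is_GZNT (Q_transform Q \<tau>) a"
  obtains b M where "a \<in> closed_upper_sphere" "b \<in> closed_upper_sphere" "a \<noteq> b"
    "M holomorphic_on upper_half_plane" "\<And>z. Im z > 0 \<Longrightarrow> Im (M z) \<ge> 0" "\<And>z. Im z > 0 \<Longrightarrow> M z \<noteq> 0"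
    "\<forall>\<^sub>\<approx>z\<in>upper_half_plane. Q_transform Q \<tau> z = root_form a z / root_form b z * M z"
proof -
  obtain b M where ab: "a \<in> closed_upper_sphere" "b \<in> closed_upper_sphere"
    and M: "M holomorphic_on upper_half_plane" "\<And>z. Im z > 0 \<Longrightarrow> Im (M z) \<ge> 0"
    and fac: "\<forall>\<^sub>\<approx>z\<in>upper_half_plane. Q_transform Q \<tau> z = root_form a z / root_form b z * M z"
    using is_GZNT_factorization[OF a] by blast
  have H: "\<forall>\<^sub>\<approx>z\<in>upper_half_plane. z \<in> upper_half_plane"
    by (intro eventually_in_cosparse upper_half_plane_topology order_refl)
  have ImQ: "Im (Q z) \<ge> 0" if "Im (Q_transform Q \<tau> z) \<ge> 0" for z
  proof -
    obtain \<kappa> where "\<kappa> \<ge> 0" "circle_form (line_circle \<tau>) (Q z) = of_real \<kappa> * Q_transform Q \<tau> z"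
      using circle_form_line_circle[of \<tau> Q z] by blast
    then have "Im (Q z) = \<kappa> * Im (Q_transform Q \<tau> z)" using Im_circle_form[of "line_circle \<tau>" "Q z"] by simp
    then show ?thesis using \<open>\<kappa> \<ge> 0\<close> that by simp
  qed
  have ne: "a \<noteq> b"
  proof
    assume "a = b"
    have "\<forall>\<^sub>\<approx>z\<in>upper_half_plane. Im (Q z) \<ge> 0"
      using fac H
    proof eventually_elim
      case (elim z)
      have "Q_transform Q \<tau> z = M z \<or> Q_transform Q \<tau> z = 0"
        using elim(1) \<open>a = b\<close> by (cases "root_form b z = 0") simp_all
      then have "Im (Q_transform Q \<tau> z) \<ge> 0" using M(2)[of z] elim(2) by auto
      then show ?case by (rule ImQ)
    qed
    then show False using class_N1_not_Im_nonneg[OF Q] by simp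
  qed
  have nz: "M z \<noteq> 0" if z: "Im z > 0" for z
  proof
    assume "M z = 0"
    then have M0: "M w = 0" if "Im w > 0" for w
      using Im_nonneg_imp_constant[OF M z _ that] by simp
    have "\<forall>\<^sub>\<approx>z\<in>upper_half_plane. Im (Q z) \<ge> 0"
      using fac H by eventually_elim (rule ImQ, simp add: M0)
    then show False using class_N1_not_Im_nonneg[OF Q] by simp
  qed
  show ?thesis by (rule that[OF ab ne M nz fac])
qed

text \<open>
  The factorization restated as a closed condition on \<open>\<tau>\<close>, \<open>a\<close> and \<open>b\<close>. It is tested at the points
  where \<open>Q\<close> is analytic, a set that does not depend on \<open>\<tau>\<close>.
\<close>

lemma GZNT_nonneg:
  assumes a: "is_GZNT (Q_transform Q \<tau>) a"
  shows "\<exists>b\<in>closed_upper_sphere. \<forall>z. Im z > 0 \<longrightarrow> Q analytic_on {z} \<longrightarrow>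
     Im (circle_form (line_circle \<tau>) (Q z) * root_form b z * cnj (root_form a z)) \<ge> 0"
proof -
  obtain b M where ab: "a \<in> closed_upper_sphere" "b \<in> closed_upper_sphere"
    and M: "M holomorphic_on upper_half_plane" "\<And>z. Im z > 0 \<Longrightarrow> Im (M z) \<ge> 0"
    and fac: "\<forall>\<^sub>\<approx>z\<in>upper_half_plane. Q_transform Q \<tau> z = root_form a z / root_form b z * M z"
    using is_GZNT_factorization[OF a] by blast
  show ?thesis
  proof (intro bexI[OF _ ab(2)] allI impI)
    fix z assume z: "Im z > 0" "Q analytic_on {z}"
    let ?g = "\<lambda>z. Im (circle_form (line_circle \<tau>) (Q z) * root_form b z * cnj (root_form a z))"
    show "?g z \<ge> 0"
    proof (rule continuous_nonneg_at[where g = ?g and z = z])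
      have "isCont Q z" using z(2) by (rule analytic_at_imp_isCont)
      then show "isCont ?g z" unfolding circle_form_def
        by (intro continuous_Im continuous_mult continuous_cnj isCont_root_form continuous_add continuous_diff
            continuous_const continuous_of_real continuous_power continuous_norm)
      have "eventually (\<lambda>w. w \<in> upper_half_plane) (at z)"
        using z(1) upper_half_plane_topology(1) by (intro eventually_at_in_open') auto
      moreover have "eventually (\<lambda>z. Q_transform Q \<tau> z = root_form a z / root_form b z * M z) (at z)"
        using fac z(1) by (auto simp: eventually_cosparse_open_eq upper_half_plane_topology)
      ultimately show "eventually (\<lambda>w. ?g w \<ge> 0) (at z)"
      proof eventually_elim
        case (elim w)
        obtain \<kappa> where \<kappa>: "\<kappa> \<ge> 0" "circle_form (line_circle \<tau>) (Q w) = of_real \<kappa> * Q_transform Q \<tau> w"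
          using circle_form_line_circle[of \<tau> Q w] by blast
        show "?g w \<ge> 0"
        proof (cases "root_form b w = 0")
          case False
          then have "circle_form (line_circle \<tau>) (Q w) * root_form b w * cnj (root_form a w) =
              of_real \<kappa> * (root_form a w * cnj (root_form a w)) * M w"
            unfolding \<kappa>(2) elim(2) by simp
          also have "\<dots> = of_real (\<kappa> * (norm (root_form a w))\<^sup>2) * M w"
            by (simp only: complex_norm_square of_real_mult)
          finally have eq: "circle_form (line_circle \<tau>) (Q w) * root_form b w * cnj (root_form a w) =
              of_real (\<kappa> * (norm (root_form a w))\<^sup>2) * M w" .
          have "Im (of_real r * y) = r * Im y" for r y by simp
          then have "?g w = \<kappa> * (norm (root_form a w))\<^sup>2 * Im (M w)" unfolding eq .
          then show ?thesis using M(2)[of w] \<kappa>(1) elim(1) by simp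
        qed simp
      qed
    qed
  qed
qed

text \<open>
  Conversely, the closed condition determines the zero parameter.
\<close>

lemma GZNT_unique_of_nonneg:
  assumes Q: "class_N1 Q" and a0: "is_GZNT (Q_transform Q \<tau>) a0"
    and a: "a \<in> closed_upper_sphere" and b: "b \<in> closed_upper_sphere"
    and nonneg: "\<And>z. \<lbrakk>Im z > 0; Q analytic_on {z}\<rbrakk> \<Longrightarrow>
     Im (circle_form (line_circle \<tau>) (Q z) * root_form b z * cnj (root_form a z)) \<ge> 0"
  shows "a = a0"
proof -
  obtain b0 M where ab0: "a0 \<in> closed_upper_sphere" "b0 \<in> closed_upper_sphere" "a0 \<noteq> b0"
    and M: "M holomorphic_on upper_half_plane" "\<And>z. Im z > 0 \<Longrightarrow> Im (M z) \<ge> 0" "\<And>z. Im z > 0 \<Longrightarrow> M z \<noteq> 0"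
    and fac: "\<forall>\<^sub>\<approx>z\<in>upper_half_plane. Q_transform Q \<tau> z = root_form a0 z / root_form b0 z * M z"
    using N1_GZNT_factorization[OF Q a0] by blast
  have mero: "Q meromorphic_on upper_half_plane" using Q by (simp add: class_N1_def)
  have an: "\<forall>\<^sub>\<approx>z\<in>upper_half_plane. Q analytic_on {z}"
    by (rule meromorphic_on_imp_analytic_cosparse[OF mero])
  have H: "\<forall>\<^sub>\<approx>z\<in>upper_half_plane. z \<in> upper_half_plane"
    by (intro eventually_in_cosparse upper_half_plane_topology order_refl)
  have generic: "\<forall>\<^sub>\<approx>z\<in>upper_half_plane. z \<noteq> w" for w
    by (auto simp: eventually_cosparse_open_eq upper_half_plane_topology intro: eventually_neq_at_within)
  have scale: "Im (of_real r * y) = r * Im y" for r y by simp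
  have ne: "a \<noteq> b"
  proof
    assume eq: "a = b"
    have "\<forall>\<^sub>\<approx>z\<in>upper_half_plane. Im (Q z) \<ge> 0"
      using an H generic[of "the a"]
    proof eventually_elim
      case (elim z)
      then have "root_form a z \<noteq> 0" using root_form_eq_0_iff[OF a] by auto
      then have pos: "(norm (root_form a z))\<^sup>2 > 0" by simp
      have "circle_form (line_circle \<tau>) (Q z) * root_form b z * cnj (root_form a z) =
          of_real ((norm (root_form a z))\<^sup>2) * circle_form (line_circle \<tau>) (Q z)"
        using eq by (simp only: complex_norm_square mult_ac)
      then have "(norm (root_form a z))\<^sup>2 * Im (circle_form (line_circle \<tau>) (Q z)) \<ge> 0"
        using nonneg[of z] elim by (simp only: mem_Collect_eq scale)
      then show ?case using pos unfolding Im_circle_form by (metis linorder_not_le zero_le_mult_iff)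
    qed
    then show False using class_N1_not_Im_nonneg[OF Q] by simp
  qed
  show ?thesis
  proof (rule zero_parameter_unique[OF M(1,2,3) ab0(1,2) a b ab0(3) ne])
    fix z :: complex assume z: "Im z > 0"
    let ?g = "\<lambda>z. Im (M z * (root_form a0 z * root_form b z) * cnj (root_form b0 z * root_form a z))"
    show "?g z \<ge> 0"
    proof (rule continuous_nonneg_at[where g = ?g and z = z])
      have "isCont M z"
        using z by (intro holomorphic_on_open_imp_isCont[OF M(1)] upper_half_plane_topology) auto
      then show "isCont ?g z"
        by (intro continuous_Im continuous_mult continuous_cnj isCont_root_form)
      have "\<forall>\<^sub>\<approx>z\<in>upper_half_plane. ?g z \<ge> 0"
        using an H fac
      proof eventually_elim
        case (elim w)
        obtain \<kappa> where \<kappa>: "\<kappa> \<ge> 0" "circle_form (line_circle \<tau>) (Q w) = of_real \<kappa> * Q_transform Q \<tau> w"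
            "Q_transform Q \<tau> w \<noteq> 0 \<Longrightarrow> \<kappa> > 0"
          using circle_form_line_circle[of \<tau> Q w] by blast
        show ?case
        proof (cases "Q_transform Q \<tau> w = 0 \<or> root_form b0 w = 0")
          case True
          then have "M w * root_form a0 w * cnj (root_form b0 w) = 0" using elim(3) by auto
          then show ?thesis by auto
        next
          case False
          define n where "n = (norm (root_form b0 w))\<^sup>2"
          have n: "of_real n = root_form b0 w * cnj (root_form b0 w)"
            unfolding n_def by (simp only: complex_norm_square)
          have eq: "of_real n * Q_transform Q \<tau> w = M w * root_form a0 w * cnj (root_form b0 w)"
            unfolding n elim(3) using False by simp
          have "\<kappa> > 0" using \<kappa>(3) False by blast
          let ?E = "M w * (root_form a0 w * root_form b w) * cnj (root_form b0 w * root_form a w)"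
          let ?W = "circle_form (line_circle \<tau>) (Q w) * root_form b w * cnj (root_form a w)"
          have "of_real n * ?W = of_real \<kappa> * (of_real n * Q_transform Q \<tau> w) * (root_form b w * cnj (root_form a w))"
            unfolding \<kappa>(2) by (simp only: mult_ac)
          also have "\<dots> = of_real \<kappa> * ?E"
            unfolding eq by (simp only: complex_cnj_mult mult_ac)
          finally have "Im (of_real n * ?W) = Im (of_real \<kappa> * ?E)" by (rule arg_cong)
          then have "n * Im ?W = \<kappa> * Im ?E" by (simp only: scale)
          moreover have "n * Im ?W \<ge> 0"
            by (intro mult_nonneg_nonneg nonneg) (use elim in \<open>simp_all add: n_def\<close>)
          ultimately have "\<kappa> * Im ?E \<ge> 0" by (simp only:)
          then show ?thesis using \<open>\<kappa> > 0\<close> by (metis linorder_not_le zero_le_mult_iff)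
        qed
      qed
      then show "eventually (\<lambda>w. ?g w \<ge> 0) (at z)"
        using z by (auto simp: eventually_cosparse_open_eq upper_half_plane_topology)
    qed
  qed
qed


section \<open>Injectivity and continuity\<close>

text \<open>
  The numbers \<open>c\<close> and \<open>s\<close> are homogeneous coordinates of \<open>\<tau>\<close>, and the equation expresses \<open>Q z\<close>
  through \<open>Q\<^sub>\<tau>\<close>. A nonzero value of the transform guarantees that its denominator does not vanish.
\<close>

lemma transform_inverse:
  obtains c s :: complex where
    "\<And>Q z. Q_transform Q \<tau> z \<noteq> 0 \<Longrightarrow> Q z * (c - s * Q_transform Q \<tau> z) = s + c * Q_transform Q \<tau> z"
    "(case \<tau> of None \<Rightarrow> c = 0 \<and> s = 1 | Some t \<Rightarrow> c = 1 \<and> s = of_real t)"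
proof (cases \<tau>)
  case None
  have "Q z * (0 - 1 * Q_transform Q \<tau> z) = 1 + 0 * Q_transform Q \<tau> z" if "Q_transform Q \<tau> z \<noteq> 0" for Q z
    using that None by auto
  then show ?thesis using None that[of 0 1] by simp
next
  case (Some t)
  have "Q z * (1 - of_real t * Q_transform Q \<tau> z) = of_real t + 1 * Q_transform Q \<tau> z"
    if "Q_transform Q \<tau> z \<noteq> 0" for Q z
  proof -
    define P where "P = Q_transform Q \<tau> z"
    have "1 + of_real t * Q z \<noteq> 0" using that Some by auto
    then have "P * (1 + of_real t * Q z) = Q z - of_real t" using Some by (simp add: P_def)
    then show ?thesis unfolding P_def[symmetric] by (simp add: algebra_simps)
  qed
  then show ?thesis using Some that[of 1 "of_real t"] by simp
qed

text \<open>
  On the path towards a common zero parameter both transforms tend to \<open>0\<close>, so \<open>Q\<close> would tend to both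
  values. To avoid the exceptional points of \<open>Q\<close> on the path, \<open>Q\<close> is eliminated first: the resulting
  relation \<open>D = 0\<close> between the two factorizations extends by continuity to the whole half-plane
  except for the pole parameters.
\<close>

lemma GZNT_inj:
  assumes Q: "class_N1 Q" and a1: "is_GZNT (Q_transform Q \<tau>1) a" and a2: "is_GZNT (Q_transform Q \<tau>2) a"
  shows "\<tau>1 = \<tau>2"
proof -
  obtain b1 M1 where a: "a \<in> closed_upper_sphere" and b1: "b1 \<in> closed_upper_sphere" "a \<noteq> b1"
    and M1: "M1 holomorphic_on upper_half_plane" "\<And>z. Im z > 0 \<Longrightarrow> Im (M1 z) \<ge> 0" "\<And>z. Im z > 0 \<Longrightarrow> M1 z \<noteq> 0"
    and fac1: "\<forall>\<^sub>\<approx>z\<in>upper_half_plane. Q_transform Q \<tau>1 z = root_form a z / root_form b1 z * M1 z"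
    by (rule N1_GZNT_factorization[OF Q a1]) (rule that, assumption+)
  obtain b2 M2 where "a \<in> closed_upper_sphere" and b2: "b2 \<in> closed_upper_sphere" "a \<noteq> b2"
    and M2: "M2 holomorphic_on upper_half_plane" "\<And>z. Im z > 0 \<Longrightarrow> Im (M2 z) \<ge> 0" "\<And>z. Im z > 0 \<Longrightarrow> M2 z \<noteq> 0"
    and fac2: "\<forall>\<^sub>\<approx>z\<in>upper_half_plane. Q_transform Q \<tau>2 z = root_form a z / root_form b2 z * M2 z"
    by (rule N1_GZNT_factorization[OF Q a2]) (rule that, assumption+)
  obtain c1 s1 where cs1: "\<And>Q z. Q_transform Q \<tau>1 z \<noteq> 0 \<Longrightarrow> Q z * (c1 - s1 * Q_transform Q \<tau>1 z) = s1 + c1 * Q_transform Q \<tau>1 z"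
    and t1: "case \<tau>1 of None \<Rightarrow> c1 = 0 \<and> s1 = 1 | Some t \<Rightarrow> c1 = 1 \<and> s1 = of_real t"
    by (rule transform_inverse[of \<tau>1]) (rule that, assumption+)
  obtain c2 s2 where cs2: "\<And>Q z. Q_transform Q \<tau>2 z \<noteq> 0 \<Longrightarrow> Q z * (c2 - s2 * Q_transform Q \<tau>2 z) = s2 + c2 * Q_transform Q \<tau>2 z"
    and t2: "case \<tau>2 of None \<Rightarrow> c2 = 0 \<and> s2 = 1 | Some t \<Rightarrow> c2 = 1 \<and> s2 = of_real t"
    by (rule transform_inverse[of \<tau>2]) (rule that, assumption+)
  define P1 where "P1 = (\<lambda>z. root_form a z / root_form b1 z * M1 z)"
  define P2 where "P2 = (\<lambda>z. root_form a z / root_form b2 z * M2 z)"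
  define D where "D = (\<lambda>z. (s1 + c1 * P1 z) * (c2 - s2 * P2 z) - (s2 + c2 * P2 z) * (c1 - s1 * P1 z))"
  have H: "\<forall>\<^sub>\<approx>z\<in>upper_half_plane. z \<in> upper_half_plane"
    by (intro eventually_in_cosparse upper_half_plane_topology order_refl)
  have generic: "\<forall>\<^sub>\<approx>z\<in>upper_half_plane. z \<noteq> w" for w
    by (auto simp: eventually_cosparse_open_eq upper_half_plane_topology intro: eventually_neq_at_within)
  have nz: "root_form c z \<noteq> 0" if "c \<in> closed_upper_sphere" "Im z > 0" "z \<noteq> the c" for c z
    using root_form_eq_0_iff[OF that(1,2)] that(3) by auto
  have gen: "\<forall>\<^sub>\<approx>z\<in>upper_half_plane. D z = 0"
    using fac1 fac2 H generic[of "the a"] generic[of "the b1"] generic[of "the b2"]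
  proof eventually_elim
    case (elim z)
    have z: "Im z > 0" using elim by simp
    have P: "P1 z = Q_transform Q \<tau>1 z" "P2 z = Q_transform Q \<tau>2 z"
      using elim by (simp_all add: P1_def P2_def)
    have "P1 z \<noteq> 0" "P2 z \<noteq> 0"
      using nz[OF a z] nz[OF b1(1) z] nz[OF b2(1) z] M1(3)[OF z] M2(3)[OF z] elim
      by (simp_all add: P1_def P2_def)
    then have 1: "Q z * (c1 - s1 * P1 z) = s1 + c1 * P1 z" and 2: "Q z * (c2 - s2 * P2 z) = s2 + c2 * P2 z"
      using cs1[of Q z] cs2[of Q z] by (simp_all add: P)
    show "D z = 0" unfolding D_def 1[symmetric] 2[symmetric] by simp
  qed
  have D0: "D z = 0" if z: "Im z > 0" "z \<noteq> the b1" "z \<noteq> the b2" for z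
  proof -
    have "isCont M1 z" "isCont M2 z"
      using z by (auto intro!: holomorphic_on_open_imp_isCont[OF M1(1)] holomorphic_on_open_imp_isCont[OF M2(1)]
          upper_half_plane_topology)
    then have "isCont D z" unfolding D_def P1_def P2_def
      by (intro isCont_diff isCont_mult isCont_add isCont_divide isCont_root_form continuous_const
          nz[OF b1(1) z(1,2)] nz[OF b2(1) z(1,3)])
    then have "(D \<longlongrightarrow> D z) (at z)" by (simp add: isCont_def)
    moreover have "eventually (\<lambda>w. D w = 0) (at z)"
      using gen z(1) by (auto simp: eventually_cosparse_open_eq upper_half_plane_topology)
    then have "(D \<longlongrightarrow> 0) (at z)" by (rule tendsto_eventually)
    ultimately show ?thesis by (rule tendsto_unique[OF trivial_limit_at])
  qed
  have "((\<lambda>y. P1 (approach a y)) \<longlongrightarrow> 0) (at_right 0)" "((\<lambda>y. P2 (approach a y)) \<longlongrightarrow> 0) (at_right 0)"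
    unfolding P1_def P2_def
    by (intro tendsto_0_at_zero_parameter M1 M2 a b1 b2; assumption)+
  then have "((\<lambda>y. D (approach a y)) \<longlongrightarrow> (s1 + c1 * 0) * (c2 - s2 * 0) - (s2 + c2 * 0) * (c1 - s1 * 0)) (at_right 0)"
    unfolding D_def by (intro tendsto_intros)
  moreover have "eventually (\<lambda>y. D (approach a y) = 0) (at_right 0)"
    using eventually_at_right_less[of 0] approach_eventually_neq[of a "the b1"] approach_eventually_neq[of a "the b2"]
  proof eventually_elim
    case (elim y)
    then show ?case by (intro D0 Im_approach_pos[OF a])
  qed
  then have "((\<lambda>y. D (approach a y)) \<longlongrightarrow> 0) (at_right 0)" by (rule tendsto_eventually)
  ultimately have "(s1 + c1 * 0) * (c2 - s2 * 0) - (s2 + c2 * 0) * (c1 - s1 * 0) = 0"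
    using tendsto_unique[OF trivial_limit_at_right_real] by blast
  then show ?thesis using t1 t2 by (auto split: option.splits)
qed

text \<open>
  By uniqueness, the graph of the zero parameter is the projection, along the compact set of pole
  parameters, of the closed set described by the sign condition. A function with closed graph into a
  compact space is continuous.
\<close>

lemma GZNT_coordinate_continuous:
  assumes Q: "class_N1 Q" and \<alpha>: "\<And>\<tau>. is_GZNT (Q_transform Q \<tau>) (\<alpha> \<tau>)"
  shows "continuous_map extended_real_line euclidean (sphere_coord \<circ> \<alpha>)"
proof -
  define T where "T = sphere_coord ` closed_upper_sphere"
  define f where "f = (\<lambda>u. sphere_coord (\<alpha> (inv_into UNIV line_circle u)))"
  define rf where "rf = (\<lambda>q z. of_real (1 - Im q) * z\<^sup>2 - of_real (Re q) * z + of_real (Im q) :: complex)"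
  have rf: "root_form a z = rf (sphere_coord a) z" for a z
    unfolding rf_def by (rule root_form_sphere_coord)
  have inj: "inj line_circle" and range: "range line_circle = sphere 0 1"
    using homeomorphic_map_line_circle
    by (auto simp: homeomorphic_eq_everything_map extended_real_line_compact_Hausdorff)
  have adm: "\<alpha> \<tau> \<in> closed_upper_sphere" for \<tau>
    using is_GZNT_factorization[OF \<alpha>[of \<tau>]] by blast
  have T: "compact T"
  proof -
    have "compactin riemann_sphere closed_upper_sphere"
      by (rule closedin_compact_space[OF riemann_sphere_compact_Hausdorff(1) closedin_closed_upper_sphere])
    from image_compactin[OF this continuous_map_sphere_coord] show ?thesis
      by (simp add: T_def)
  qed
  have "continuous_on (sphere 0 1) f"
  proof (rule continuous_from_closed_graph[OF T])
    show "f \<in> sphere 0 1 \<rightarrow> T" using adm by (auto simp: f_def T_def)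
    show "closed ((\<lambda>u. (u, f u)) ` sphere 0 1)"
      unfolding closed_sequential_limits
    proof (intro allI impI, elim conjE)
      fix X l assume X: "\<forall>n. X n \<in> (\<lambda>u. (u, f u)) ` sphere 0 1" and lim: "X \<longlonglongrightarrow> l"
      define u where "u = (\<lambda>n. fst (X n))"
      have u: "u n \<in> sphere 0 1" "X n = (u n, f (u n))" for n
        using X by (auto simp: u_def dest!: spec[of _ n])
      have lim_u: "u \<longlonglongrightarrow> fst l" and lim_f: "(\<lambda>n. f (u n)) \<longlonglongrightarrow> snd l"
        using tendsto_fst[OF lim] tendsto_snd[OF lim] u(2) by (simp_all add: u_def[symmetric])
      have "fst l \<in> sphere 0 1"
        using lim_u u(1) by (metis closed_sequentially closed_sphere)
      then obtain \<tau> where \<tau>: "fst l = line_circle \<tau>" using range by blast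
      define t where "t = (\<lambda>n. inv_into UNIV line_circle (u n))"
      have t: "line_circle (t n) = u n" for n
        unfolding t_def using u(1)[of n] range by (intro f_inv_into_f) simp
      have fT: "f (u n) \<in> T" for n unfolding f_def T_def by (rule imageI[OF adm])
      have "snd l \<in> T"
        by (rule closed_sequentially[OF compact_imp_closed[OF T] fT lim_f])
      then obtain a where a: "a \<in> closed_upper_sphere" "snd l = sphere_coord a" by (auto simp: T_def)
      have "\<forall>n. \<exists>b\<in>closed_upper_sphere. \<forall>z. Im z > 0 \<longrightarrow> Q analytic_on {z} \<longrightarrow>
          Im (circle_form (line_circle (t n)) (Q z) * root_form b z * cnj (root_form (\<alpha> (t n)) z)) \<ge> 0"
        using GZNT_nonneg[OF \<alpha>] by blast
      from choice[OF this[unfolded Bex_def]] obtain b where b: "\<And>n. b n \<in> closed_upper_sphere"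
        and nonneg: "\<And>n z. \<lbrakk>Im z > 0; Q analytic_on {z}\<rbrakk> \<Longrightarrow>
          Im (circle_form (line_circle (t n)) (Q z) * root_form (b n) z * cnj (root_form (\<alpha> (t n)) z)) \<ge> 0"
        by auto
      have bT: "\<forall>n. sphere_coord (b n) \<in> T" unfolding T_def using b by blast
      \<comment> \<open>Along a subsequence the pole parameters converge too.\<close>
      obtain q and r :: "nat \<Rightarrow> nat" where q: "q \<in> T" and r: "strict_mono r" and lim_b: "((\<lambda>n. sphere_coord (b n)) \<circ> r) \<longlonglongrightarrow> q"
        by (rule seq_compactE[OF compact_imp_seq_compact[OF T] bT]) (rule that)
      obtain b' where b': "b' \<in> closed_upper_sphere" "q = sphere_coord b'" using q by (auto simp: T_def)
      have "a = \<alpha> \<tau>"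
      proof (rule GZNT_unique_of_nonneg[OF Q \<alpha> a(1) b'(1)])
        fix z assume z: "Im z > 0" "Q analytic_on {z}"
        have "(\<lambda>n. Im (circle_form (u (r n)) (Q z) * rf (sphere_coord (b (r n))) z * cnj (rf (f (u (r n))) z)))
          \<longlonglongrightarrow> Im (circle_form (fst l) (Q z) * rf q z * cnj (rf (snd l) z))"
          unfolding circle_form_def rf_def
          using LIMSEQ_subseq_LIMSEQ[OF lim_u r] LIMSEQ_subseq_LIMSEQ[OF lim_f r] lim_b
          by (intro tendsto_intros) (simp_all add: o_def)
        moreover have "Im (circle_form (u (r n)) (Q z) * rf (sphere_coord (b (r n))) z * cnj (rf (f (u (r n))) z)) \<ge> 0" for n
          using nonneg[OF z, of "r n"] by (simp only: t rf) (simp only: f_def t_def)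
        ultimately have "Im (circle_form (fst l) (Q z) * rf q z * cnj (rf (snd l) z)) \<ge> 0"
          by (intro tendsto_lowerbound[OF _ always_eventually]) auto
        then show "Im (circle_form (line_circle \<tau>) (Q z) * root_form b' z * cnj (root_form a z)) \<ge> 0"
          by (simp only: rf \<tau> b'(2) a(2))
      qed
      then have "snd l = f (fst l)" using a(2) \<tau> inj by (simp add: f_def)
      then show "l \<in> (\<lambda>u. (u, f u)) ` sphere 0 1"
        using \<open>fst l \<in> sphere 0 1\<close> by (intro image_eqI[of _ _ "fst l"]) (simp_all add: prod_eq_iff)
    qed
  qed
  then have "continuous_map (top_of_set (sphere 0 1)) euclidean f" by simp
  moreover have "continuous_map extended_real_line (top_of_set (sphere 0 1)) line_circle"
    using homeomorphic_map_line_circle by (rule homeomorphic_imp_continuous_map)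
  ultimately have "continuous_map extended_real_line euclidean (f \<circ> line_circle)"
    by (rule continuous_map_compose[rotated])
  moreover have "f \<circ> line_circle = sphere_coord \<circ> \<alpha>"
    using inj by (auto simp: f_def)
  ultimately show ?thesis by simp
qed

theorem theorem3p2:
  fixes Q :: "complex \<Rightarrow> complex" and \<alpha> :: "real option \<Rightarrow> complex option"
  assumes "class_N1 Q"
    and "\<And>\<tau>. is_GZNT (Q_transform Q \<tau>) (\<alpha> \<tau>)"
  shows "continuous_map extended_real_line riemann_sphere \<alpha> \<and>
         subtopology riemann_sphere (range \<alpha>) homeomorphic_space top_of_set (sphere (0 :: complex) 1)"
proof -
  note top = extended_real_line_compact_Hausdorff riemann_sphere_compact_Hausdorff
  have adm: "\<alpha> \<tau> \<in> closed_upper_sphere" for \<tau>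
    using is_GZNT_factorization[OF assms(2)[of \<tau>]] by blast
  have cont: "continuous_map extended_real_line riemann_sphere \<alpha>"
    unfolding continuous_map_closedin
  proof (intro conjI allI impI)
    fix C assume C: "closedin riemann_sphere C"
    have "compactin riemann_sphere (C \<inter> closed_upper_sphere)"
      using C closedin_closed_upper_sphere by (intro closedin_compact_space closedin_Int top)
    from image_compactin[OF this continuous_map_sphere_coord]
    have "closed (sphere_coord ` (C \<inter> closed_upper_sphere))"
      by (simp add: compact_imp_closed)
    then have "closedin extended_real_line
        {\<tau> \<in> topspace extended_real_line. (sphere_coord \<circ> \<alpha>) \<tau> \<in> sphere_coord ` (C \<inter> closed_upper_sphere)}"
      by (intro closedin_continuous_map_preimage[OF GZNT_coordinate_continuous[OF assms]]) simp
    moreover have "(sphere_coord \<circ> \<alpha>) \<tau> \<in> sphere_coord ` (C \<inter> closed_upper_sphere) \<longleftrightarrow> \<alpha> \<tau> \<in> C" for \<tau>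
      using adm[of \<tau>] inj_on_sphere_coord by (auto dest: inj_onD)
    ultimately show "closedin extended_real_line {\<tau> \<in> topspace extended_real_line. \<alpha> \<tau> \<in> C}" by simp
  qed (simp add: top)
  have "inj \<alpha>"
  proof (rule injI)
    fix \<sigma> \<tau> assume "\<alpha> \<sigma> = \<alpha> \<tau>"
    then show "\<sigma> = \<tau>" using GZNT_inj[OF assms(1) assms(2)[of \<sigma>]] assms(2)[of \<tau>] by simp
  qed
  then have "embedding_map extended_real_line riemann_sphere \<alpha>"
    by (intro continuous_imp_embedding_map cont) (simp_all add: top)
  then have "extended_real_line homeomorphic_space subtopology riemann_sphere (range \<alpha>)"
    using embedding_map_imp_homeomorphic_space[of extended_real_line riemann_sphere \<alpha>] by (simp add: top)
  moreover have "extended_real_line homeomorphic_space top_of_set (sphere (0 :: complex) 1)"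
    using homeomorphic_map_line_circle by (rule homeomorphic_map_imp_homeomorphic_space)
  ultimately have "subtopology riemann_sphere (range \<alpha>) homeomorphic_space top_of_set (sphere (0 :: complex) 1)"
    using homeomorphic_space_sym homeomorphic_space_trans by blast
  with cont show ?thesis by simp
qed

end
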